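(* (1) A biconnected graph $G$ is critical if and only if every part of $G$ that is a block and every part of $G$ that is a cycle of length $3$ has empty interior. (2) Let $G$ be a critical biconnected graph, let $A\in\mathrm{Part}(G)$ be a terminal part, and let $S$ be the single cutset adjacent to $A$ in $\mathrm{BT}(G)$. Then $A$ is a cycle with at least four vertices, and every vertex of $A$ other than the two vertices of $S$ has degree $2$ in $G$. (3) Every critical biconnected graph has at least four vertices of degree $2$.
   Context: All graphs are finite, undirected, without loops or multiple edges; $G(U)$ is the subgraph induced on $U$. A connected component means the vertex set of a maximal connected subgraph. A set $R\subset V(G)$ is a cutset if $G-R$ (delete the vertices of $R$) is disconnected; $\mathfrak R_2(G)$ is the set of 2-vertex cutsets. $R$ separates $X$ from $Y$ (where $X,Y\not\subset R$) if no vertex of $X\setminus R$ and no vertex of $Y\setminus R$ lie in a common connected component of $G-R$; $R$ splits $X$ if $X\setminus R$ is not contained in one connected component of $G-R$. $G$ is $k$-connected if $v(G)>k$ and it has no cutset with at most $k-1$ vertices; biconnected = 2-connected, triconnected = 3-connected. A biconnected graph $G$ is critical if $v(G)\ge 4$ and for every vertex $x$ the graph $G-x$ is not biconnected. Cutsets $S,T\in\mathfrak R_2(G)$ are independent if neither splits the other; $S$ is single if it is independent with all other cutsets in $\mathfrak R_2(G)$; $\mathfrak O(G)$ is the set of single cutsets. A set $A\subset V(G)$ is a part of $G$ if no cutset of $\mathfrak O(G)$ splits $A$ but every vertex outside $A$ is separated from $A$ by some cutset of $\mathfrak O(G)$; $\mathrm{Part}(G)$ is the set of parts. The interior $\mathrm{Int}(A)$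 of a part is the set of its vertices lying in no single cutset. $\mathrm{BT}(G)$ is the bipartite graph (a tree) whose vertices are the single cutsets and the parts of $G$, a cutset $S$ being adjacent to a part $A$ iff $S\subset A$; a part is terminal if it is a leaf of $\mathrm{BT}(G)$. $G'$ is obtained from $G$ by adding all edges $ab$ with $\{a,b\}\in\mathfrak O(G)$. A part $A$ is a block if $G'(A)$ is triconnected, and a cycle of length $|A|$ if $G'(A)$ is a simple cycle. *)

theory Defs
  imports "Graph_Theory.Graph_Theory"
begin

text \<open>
  Finite simple undirected graphs are represented by the locale \<^locale>\<open>pair_graph\<close>, in which an
  undirected edge \<open>ab\<close> is the pair of arcs \<open>(a, b)\<close>, \<open>(b, a)\<close>. The degree of a vertex is therefore its
  \<^const>\<open>in_degree\<close>. The notions below take general \<^typ>\<open>('a, 'b) pre_digraph\<close> arguments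
  because that is the type of the induced subgraphs \<open>G \<restriction> U\<close>.
\<close>

definition del_verts :: "('a, 'b) pre_digraph \<Rightarrow> 'a set \<Rightarrow> ('a, 'b) pre_digraph" where
  "del_verts G R = G \<restriction> (verts G - R)"

definition components :: "('a, 'b) pre_digraph \<Rightarrow> 'a set set" where
  "components G = verts ` {H. pre_digraph.max_subgraph G connected H}"

text \<open>
  The library does not regard the null graph as connected, so formally \<open>verts G\<close> is a cutset of \<open>G\<close>.
  Below, only cutsets with fewer vertices than \<open>G\<close> matter.
\<close>

definition cutset :: "('a, 'b) pre_digraph \<Rightarrow> 'a set \<Rightarrow> bool" where
  "cutset G R \<longleftrightarrow> R \<subseteq> verts G \<and> \<not> connected (del_verts G R)"

definition cutsets2 :: "('a, 'b) pre_digraph \<Rightarrow> 'a set set" where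
  "cutsets2 G = {R. cutset G R \<and> card R = 2}"

definition k_connected :: "nat \<Rightarrow> ('a, 'b) pre_digraph \<Rightarrow> bool" where
  "k_connected k G \<longleftrightarrow> card (verts G) > k \<and> \<not> (\<exists>R. cutset G R \<and> card R < k)"

abbreviation biconnected :: "('a, 'b) pre_digraph \<Rightarrow> bool" where
  "biconnected \<equiv> k_connected 2"

abbreviation triconnected :: "('a, 'b) pre_digraph \<Rightarrow> bool" where
  "triconnected \<equiv> k_connected 3"

definition critical :: "('a, 'b) pre_digraph \<Rightarrow> bool" where
  "critical G \<longleftrightarrow> biconnected G \<and> card (verts G) \<ge> 4 \<and>
     (\<forall>x \<in> verts G. \<not> biconnected (del_verts G {x}))"

definition separates :: "('a, 'b) pre_digraph \<Rightarrow> 'a set \<Rightarrow> 'a set \<Rightarrow> 'a set \<Rightarrow> bool" where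
  "separates G R X Y \<longleftrightarrow> \<not> X \<subseteq> R \<and> \<not> Y \<subseteq> R \<and>
     (\<forall>x \<in> X - R. \<forall>y \<in> Y - R. \<not> (\<exists>C \<in> components (del_verts G R). x \<in> C \<and> y \<in> C))"

definition splits :: "('a, 'b) pre_digraph \<Rightarrow> 'a set \<Rightarrow> 'a set \<Rightarrow> bool" where
  "splits G R X \<longleftrightarrow> \<not> (\<exists>C \<in> components (del_verts G R). X - R \<subseteq> C)"

definition independent :: "('a, 'b) pre_digraph \<Rightarrow> 'a set \<Rightarrow> 'a set \<Rightarrow> bool" where
  "independent G S T \<longleftrightarrow> \<not> splits G S T \<and> \<not> splits G T S"

definition single_cutsets :: "('a, 'b) pre_digraph \<Rightarrow> 'a set set" where
  "single_cutsets G = {S \<in> cutsets2 G. \<forall>T \<in> cutsets2 G. T \<noteq> S \<longrightarrow> independent G S T}"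

definition parts :: "('a, 'b) pre_digraph \<Rightarrow> 'a set set" where
  "parts G = {A. A \<subseteq> verts G \<and> (\<forall>S \<in> single_cutsets G. \<not> splits G S A) \<and>
     (\<forall>x \<in> verts G - A. \<exists>S \<in> single_cutsets G. separates G S {x} A)}"

definition part_interior :: "('a, 'b) pre_digraph \<Rightarrow> 'a set \<Rightarrow> 'a set" where
  "part_interior G A = {x \<in> A. \<forall>S \<in> single_cutsets G. x \<notin> S}"

definition BT :: "('a, 'b) pre_digraph \<Rightarrow> ('a set + 'a set) pair_pre_digraph" where
  "BT G = \<lparr> pverts = Inl ` single_cutsets G \<union> Inr ` parts G,
     parcs = symcl {(Inl S, Inr A) | S A. S \<in> single_cutsets G \<and> A \<in> parts G \<and> S \<subseteq> A} \<rparr>"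

definition terminal_part :: "('a, 'b) pre_digraph \<Rightarrow> 'a set \<Rightarrow> bool" where
  "terminal_part G A \<longleftrightarrow> A \<in> parts G \<and> in_degree (BT G) (Inr A) = 1"

text \<open>The graph \<open>G'\<close>. Single cutsets have two elements, so no loops are added.\<close>

definition add_cutset_edges :: "'a pair_pre_digraph \<Rightarrow> 'a pair_pre_digraph" where
  "add_cutset_edges G =
     \<lparr> pverts = pverts G, parcs = parcs G \<union> {(a, b). {a, b} \<in> single_cutsets G} \<rparr>"

definition cycle_graph :: "('a, 'b) pre_digraph \<Rightarrow> bool" where
  "cycle_graph G \<longleftrightarrow> (\<exists>vs. distinct vs \<and> length vs \<ge> 3 \<and> set vs = verts G \<and>
     arcs_ends G = symcl {(vs ! i, vs ! (Suc i mod length vs)) | i. i < length vs})"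

definition block_part :: "'a pair_pre_digraph \<Rightarrow> 'a set \<Rightarrow> bool" where
  "block_part G A \<longleftrightarrow> A \<in> parts G \<and> triconnected (add_cutset_edges G \<restriction> A)"

definition cycle_part :: "'a pair_pre_digraph \<Rightarrow> 'a set \<Rightarrow> bool" where
  "cycle_part G A \<longleftrightarrow> A \<in> parts G \<and> cycle_graph (add_cutset_edges G \<restriction> A)"

end

theory Submission
  imports Defs
begin

text \<open>
  A vertex can be deleted unless it lies in a 2-vertex cutset, so \<open>G\<close> is critical iff 2-vertex
  cutsets cover its (at least four) vertices. Two cutsets \<open>{x, y}\<close>, \<open>{s, t}\<close> splitting each other
  arrange the graph in a ring around \<open>x, s, y, t\<close>, and each corner pair such as \<open>{x, s}\<close> separates
  its own arc of the ring from the rest. Descending along corners yields two facts: if \<open>x\<close> lies in no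
  2-vertex cutset, then whatever some 2-vertex cutset separates from \<open>x\<close> is already separated from \<open>x\<close>
  by a single cutset; and if \<open>x\<close> lies in some 2-vertex cutset but in no single one, then \<open>x\<close> has
  degree 2. By the first, the part around a vertex in no 2-vertex cutset is split by no such cutset,
  so it is a block or a triangle. By the second, an interior vertex of a critical graph has degree 2;
  its two neighbours lie in the same part and isolate it there, which rules out blocks and triangles
  and makes terminal parts cycles.
\<close>

section \<open>Connectivity of induced subgraphs as reachability\<close>

lemma rtrancl_on_mono_set:
  assumes "(u, v) \<in> rtrancl_on F r" "F \<subseteq> F'" "r \<inter> F \<times> F \<subseteq> r'"
  shows "(u, v) \<in> rtrancl_on F' r'"
  using assms(1)
proof (induct rule: rtrancl_on_induct)
  case base
  then show ?case using assms by auto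
next
  case (step y z)
  then show ?case using assms by (blast intro: rtrancl_on_into_rtrancl_on)
qed

lemma del_verts_induce: "del_verts (with_proj H \<restriction> A) R = with_proj H \<restriction> (A - R)"
  by (auto simp: del_verts_def induce_subgraph_def)

text \<open>By symmetry of the arcs \<open>symcl\<close> adds nothing, and
  \<open>rtrancl_on F\<close> itself keeps walks inside \<open>F\<close>. Stated for any symmetric
  \<open>H\<close>, so that it serves both \<open>G\<close> and \<open>G'\<close>.\<close>

lemma connected_induce_iff:
  assumes "sym (parcs H)"
  shows "connected (with_proj H \<restriction> F) \<longleftrightarrow>
    F \<noteq> {} \<and> (\<forall>u\<in>F. \<forall>v\<in>F. (u, v) \<in> rtrancl_on F (parcs H))"
proof -
  have ends: "arcs_ends (with_proj H \<restriction> F) = parcs H \<inter> F \<times> F"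
    by (auto simp: arcs_ends_conv)
  have "rtrancl_on F (symcl (parcs H \<inter> F \<times> F)) = rtrancl_on F (parcs H)"
  proof (intro set_eqI iffI; clarify)
    fix u v
    show "(u, v) \<in> rtrancl_on F (symcl (parcs H \<inter> F \<times> F)) \<Longrightarrow> (u, v) \<in> rtrancl_on F (parcs H)"
      using assms by (elim rtrancl_on_mono_set) (auto simp: symcl_def dest: symD)
    show "(u, v) \<in> rtrancl_on F (parcs H) \<Longrightarrow> (u, v) \<in> rtrancl_on F (symcl (parcs H \<inter> F \<times> F))"
      by (elim rtrancl_on_mono_set) (auto simp: symcl_def)
  qed
  then show ?thesis
    unfolding connected_conv ends by simp
qed

lemma card_2_insertE:
  assumes "card S = 2" "a \<in> S"
  obtains b where "S = {a, b}" "a \<noteq> b"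
proof -
  obtain p q where "S = {p, q}" "p \<noteq> q" using assms(1) by (auto simp: card_2_iff)
  then show ?thesis using that[of p] that[of q] assms(2) by (auto simp: insert_commute)
qed

section \<open>Components of the graph after deleting vertices\<close>

context pair_graph
begin

lemma sym_parcs: "sym (parcs G)"
  using arcs_symmetric by (auto intro: symI)

text \<open>The component of \<open>G - R\<close> around \<open>u\<close>; it is empty if
  \<open>u\<close> lies in \<open>R\<close> or is not a vertex.\<close>

definition comp_of :: "'a set \<Rightarrow> 'a \<Rightarrow> 'a set" where
  "comp_of R u = {v. (u, v) \<in> rtrancl_on (pverts G - R) (parcs G)}"

lemma comp_of_subset: "v \<in> comp_of R u \<Longrightarrow> v \<in> pverts G \<and> v \<notin> R"
  by (auto simp: comp_of_def dest: in_rtrancl_on_in_F)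

lemma comp_of_refl: "u \<in> pverts G \<Longrightarrow> u \<notin> R \<Longrightarrow> u \<in> comp_of R u"
  by (auto simp: comp_of_def)

lemma comp_of_sym: "v \<in> comp_of R u \<Longrightarrow> u \<in> comp_of R v"
  using rtrancl_on_sym[OF sym_parcs] by (auto simp: comp_of_def dest: symD)

lemma comp_of_trans: "v \<in> comp_of R u \<Longrightarrow> w \<in> comp_of R v \<Longrightarrow> w \<in> comp_of R u"
  by (auto simp: comp_of_def intro: rtrancl_on_trans)

lemma comp_of_eq: "v \<in> comp_of R u \<Longrightarrow> comp_of R v = comp_of R u"
  using comp_of_trans comp_of_sym by blast

lemma comp_of_step: "v \<in> comp_of R u \<Longrightarrow> (v, w) \<in> parcs G \<Longrightarrow> w \<notin> R \<Longrightarrow> w \<in> comp_of R u"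
  by (auto simp: comp_of_def intro: rtrancl_on_into_rtrancl_on dest: in_arcsD2)

lemma comp_of_closed:
  assumes "u \<in> X" "\<And>z w. z \<in> X \<Longrightarrow> (z, w) \<in> parcs G \<Longrightarrow> w \<in> pverts G \<Longrightarrow> w \<notin> R \<Longrightarrow> w \<in> X"
  shows "comp_of R u \<subseteq> X"
proof
  fix v assume "v \<in> comp_of R u"
  then have "(u, v) \<in> rtrancl_on (pverts G - R) (parcs G)" by (simp add: comp_of_def)
  then show "v \<in> X" 
    by (induct rule: rtrancl_on_induct) (use assms in blast)+
qed

text \<open>Walks inside a component that is disjoint from \<open>R'\<close> survive the deletion of
  \<open>R'\<close>.\<close>

lemma comp_of_avoid:
  assumes "comp_of R u \<inter> R' = {}"
  shows "comp_of R u \<subseteq> comp_of R' u"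
proof (cases "u \<in> comp_of R u")
  case True
  then have "u \<in> comp_of R u \<inter> comp_of R' u"
    using assms comp_of_subset comp_of_refl by blast
  then have "comp_of R u \<subseteq> comp_of R u \<inter> comp_of R' u"
    by (rule comp_of_closed) (use assms comp_of_step in blast)
  then show ?thesis by blast
next
  case False
  then show ?thesis using comp_of_sym comp_of_trans by blast
qed

lemma connected_del_verts_iff:
  "connected (del_verts G R) \<longleftrightarrow>
    pverts G - R \<noteq> {} \<and> (\<forall>u\<in>pverts G - R. \<forall>v\<in>pverts G - R. v \<in> comp_of R u)"
  unfolding del_verts_def comp_of_def with_proj_simps connected_induce_iff[OF sym_parcs] by simp

text \<open>The subgraph \<open>K u\<close> induced on \<open>comp_of R u\<close> is connected, and
  every connected subgraph of \<open>G - R\<close> through \<open>u\<close> lies in it; so the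
  subgraphs \<open>K u\<close> are exactly the maximal connected ones.\<close>

lemma components_del_verts: "components (del_verts G R) = comp_of R ` (pverts G - R)"
proof -
  let ?H = "del_verts (with_proj G) R"
  have H_verts: "verts ?H = pverts G - R" by (simp add: del_verts_def)
  have wfH: "wf_digraph ?H"
    unfolding del_verts_def by (rule wellformed_induce_subgraph)
  define K where "K u = with_proj G \<restriction> comp_of R u" for u
  have wfK: "wf_digraph (K u)" for u
    unfolding K_def by (rule wellformed_induce_subgraph)
  have K_sub: "subgraph (K u) ?H" if "u \<in> pverts G - R" for u
    using wfK wfH comp_of_subset
    by (intro subgraphI) (auto simp: K_def del_verts_def compatible_def)
  have K_conn: "connected (K u)" if "u \<in> pverts G - R" for u
  proof -
    have from_u: "(u, v) \<in> rtrancl_on (comp_of R u) (parcs G)" if "v \<in> comp_of R u" for v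
    proof -
      have "comp_of R u \<subseteq> {v. (u, v) \<in> rtrancl_on (comp_of R u) (parcs G)} \<inter> comp_of R u"
        using comp_of_step \<open>u \<in> _\<close>
        by (intro comp_of_closed) (auto intro: rtrancl_on_into_rtrancl_on comp_of_refl)
      then show ?thesis using that by blast
    qed
    have "(v, w) \<in> rtrancl_on (comp_of R u) (parcs G)" if "v \<in> comp_of R u" "w \<in> comp_of R u" for v w
      using from_u[OF that(1)] from_u[OF that(2)] rtrancl_on_sym[OF sym_parcs]
      by (auto intro: rtrancl_on_trans dest: symD)
    then show ?thesis
      unfolding K_def connected_induce_iff[OF sym_parcs] using comp_of_refl that by blast
  qed
  have sub_K: "subgraph H' (K u)" if "subgraph H' ?H" "connected H'" "u \<in> verts H'" for H' u
  proof -
    have H': "arcs H' \<subseteq> {e \<in> parcs G. fst e \<in> pverts G - R \<and> snd e \<in> pverts G - R}"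
      "tail H' = fst" "head H' = snd" "wf_digraph H'" "verts H' \<subseteq> pverts G - R"
      using that(1) by (auto simp: subgraph_def del_verts_def compatible_def)
    have ends: "arcs_ends H' = arcs H'"
      using H' by (auto simp: arcs_ends_conv)
    have "verts H' \<subseteq> comp_of R u"
    proof
      fix v assume "v \<in> verts H'"
      then have "(u, v) \<in> rtrancl_on (verts H') (symcl (arcs_ends H'))"
        using that(2,3) by (simp add: connected_conv)
      moreover have "symcl (arcs_ends H') \<subseteq> parcs G"
        using H'(1) sym_parcs unfolding ends by (auto simp: symcl_def dest: symD)
      ultimately have "(u, v) \<in> rtrancl_on (pverts G - R) (parcs G)"
        using H'(5) by (blast intro: rtrancl_on_mono_set)
      then show "v \<in> comp_of R u" by (simp add: comp_of_def)
    qed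
    moreover have "fst e \<in> verts H' \<and> snd e \<in> verts H'" if "e \<in> arcs H'" for e
      using H' that wf_digraph.wellformed[of H' e] by auto
    ultimately show ?thesis
      using H' wfK by (intro subgraphI) (auto simp: K_def compatible_def)
  qed
  have nonempty: "verts H' \<noteq> {}" if "connected H'" for H' :: "('a, 'a \<times> 'a) pre_digraph"
    using that by (simp add: connected_conv)
  have antisym: "H' = H''" if "subgraph H' H''" "subgraph H'' H'"
    for H' H'' :: "('a, 'a \<times> 'a) pre_digraph"
    using that by (auto simp: subgraph_def compatible_def)
  show ?thesis
  proof (intro set_eqI iffI)
    fix C assume "C \<in> components ?H"
    then obtain H' where max: "pre_digraph.max_subgraph ?H connected H'" and C: "C = verts H'"
      by (auto simp: components_def)
    have H': "subgraph H' ?H" "connected H'"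
      using max by (auto simp: pre_digraph.max_subgraph_def)
    then obtain u where u: "u \<in> verts H'" using nonempty by blast
    then have uV: "u \<in> pverts G - R" using H'(1) H_verts by (auto dest: subgraph_imp_subverts)
    have "K u = H'"
      using max sub_K[OF H' u] K_sub[OF uV] K_conn[OF uV] by (auto simp: pre_digraph.max_subgraph_def)
    then show "C \<in> comp_of R ` (pverts G - R)" using uV C by (auto simp: K_def)
  next
    fix C assume "C \<in> comp_of R ` (pverts G - R)"
    then obtain u where u: "u \<in> pverts G - R" "C = comp_of R u" by blast
    have "pre_digraph.max_subgraph ?H connected (K u)"
      unfolding pre_digraph.max_subgraph_def
    proof (intro conjI allI impI notI)
      fix H' assume *: "H' \<noteq> K u \<and> subgraph (K u) H'" "subgraph H' ?H \<and> connected H'"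
      have "u \<in> verts H'"
        using * u comp_of_refl by (auto simp: K_def dest!: subgraph_imp_subverts)
      then show False using sub_K[of H' u] * antisym by blast
    qed (use K_sub K_conn u in auto)
    then show "C \<in> components ?H"
      using u by (auto simp: components_def K_def intro!: image_eqI)
  qed
qed

lemma splits_iff:
  assumes "X \<subseteq> pverts G" "pverts G - S \<noteq> {}"
  shows "splits G S X \<longleftrightarrow> (\<exists>u\<in>X - S. \<exists>v\<in>X - S. v \<notin> comp_of S u)"
proof
  assume L: "splits G S X"
  show "\<exists>u\<in>X - S. \<exists>v\<in>X - S. v \<notin> comp_of S u"
  proof (cases "X \<subseteq> S")
    \<comment> \<open>Here the set to be contained is empty, but some component must exist to
      contain it; hence the hypothesis that \<open>S\<close> leaves a vertex.\<close>
    case True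
    then show ?thesis using L assms(2) by (auto simp: splits_def components_del_verts)
  next
    case False
    then obtain u where u: "u \<in> X - S" by blast
    then have "\<not> X - S \<subseteq> comp_of S u"
      using L assms(1) by (auto simp: splits_def components_del_verts)
    then show ?thesis using u by blast
  qed
next
  assume "\<exists>u\<in>X - S. \<exists>v\<in>X - S. v \<notin> comp_of S u"
  then show "splits G S X"
    unfolding splits_def components_del_verts using comp_of_sym comp_of_trans by blast
qed

lemma separates_iff:
  assumes "X \<subseteq> pverts G"
  shows "separates G R X Y \<longleftrightarrow>
    \<not> X \<subseteq> R \<and> \<not> Y \<subseteq> R \<and> (\<forall>x\<in>X - R. \<forall>y\<in>Y - R. y \<notin> comp_of R x)"
proof -
  have "(\<exists>C \<in> components (del_verts G R). x \<in> C \<and> y \<in> C) \<longleftrightarrow> y \<in> comp_of R x"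
    if "x \<in> X - R" for x y
  proof
    assume "\<exists>C \<in> components (del_verts G R). x \<in> C \<and> y \<in> C"
    then show "y \<in> comp_of R x"
      unfolding components_del_verts using comp_of_sym comp_of_trans by blast
  next
    assume "y \<in> comp_of R x"
    moreover have "x \<in> pverts G - R" using that assms by blast
    ultimately show "\<exists>C \<in> components (del_verts G R). x \<in> C \<and> y \<in> C"
      unfolding components_del_verts using comp_of_refl by blast
  qed
  then show ?thesis unfolding separates_def by simp
qed

lemma in_degree_eq_card: "in_degree G x = card {y. (x, y) \<in> parcs G}"
proof -
  have "in_arcs G x = (\<lambda>y. (y, x)) ` {y. (x, y) \<in> parcs G}"
    using arcs_symmetric by (auto simp: in_arcs_def)
  then show ?thesis by (simp add: in_degree_def card_image inj_on_def)
qed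

end

section \<open>Two-vertex cutsets of biconnected graphs\<close>

locale biconnected_graph = pair_graph +
  assumes biconnected: "biconnected G"
begin

lemma card_verts: "card (pverts G) > 2"
  using biconnected by (simp add: k_connected_def)

lemma finite_V: "finite (pverts G)"
  by (rule pair_finite_verts)

lemma ex_vert_not_in: "card S \<le> 2 \<Longrightarrow> finite S \<Longrightarrow> \<exists>w \<in> pverts G. w \<notin> S"
  using card_verts card_mono[of S "pverts G"] by fastforce

lemma verts_diff_nonempty: "card S = 2 \<Longrightarrow> pverts G - S \<noteq> {}"
  using ex_vert_not_in[of S] by (metis DiffI empty_iff card.infinite order_refl zero_neq_numeral)

lemma comp_of_small:
  assumes "R \<subseteq> pverts G" "card R < 2" "u \<in> pverts G - R" "v \<in> pverts G - R"
  shows "v \<in> comp_of R u"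
proof -
  have "\<not> cutset G R" using biconnected assms(2) by (auto simp: k_connected_def)
  then show ?thesis
    using assms connected_del_verts_iff[of R] by (auto simp: cutset_def)
qed

lemma cutsets2_iff:
  "R \<in> cutsets2 G \<longleftrightarrow> R \<subseteq> pverts G \<and> card R = 2 \<and>
    (\<exists>u\<in>pverts G - R. \<exists>v\<in>pverts G - R. v \<notin> comp_of R u)"
  unfolding cutsets2_def cutset_def connected_del_verts_iff
  using verts_diff_nonempty by auto

lemma cutsets2I:
  assumes "x \<in> pverts G" "y \<in> pverts G" "x \<noteq> y" "u \<in> pverts G - {x, y}" "v \<in> pverts G - {x, y}"
    "v \<notin> comp_of {x, y} u"
  shows "{x, y} \<in> cutsets2 G"
  unfolding cutsets2_iff using assms by (intro conjI bexI[of _ u] bexI[of _ v]) auto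

lemma cutsets2D:
  assumes "R \<in> cutsets2 G"
  shows "R \<subseteq> pverts G" "card R = 2" "pverts G - R \<noteq> {}" "finite R"
  using assms verts_diff_nonempty unfolding cutsets2_iff by (auto intro: card_ge_0_finite)

lemma single_in_cutsets2: "S \<in> single_cutsets G \<Longrightarrow> S \<in> cutsets2 G"
  by (simp add: single_cutsets_def)

lemma comp_of_other:
  assumes "R \<in> cutsets2 G"
  obtains v where "v \<in> pverts G - R" "v \<notin> comp_of R u"
proof -
  obtain p q where "p \<in> pverts G - R" "q \<in> pverts G - R" "q \<notin> comp_of R p"
    using assms by (auto simp: cutsets2_iff)
  then show ?thesis using that[of p] that[of q] comp_of_eq[of p R u] by blast
qed

text \<open>Otherwise the other vertex of \<open>S\<close> alone would cut this component off from
  \<open>a\<close>, against biconnectivity.\<close>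

lemma comp_of_touch:
  assumes "S \<subseteq> pverts G" "card S = 2" "u \<in> pverts G - S" "a \<in> S"
  shows "\<exists>w\<in>comp_of S u. (w, a) \<in> parcs G"
proof (rule ccontr)
  assume no: "\<not> ?thesis"
  obtain b where b: "S = {a, b}" "a \<noteq> b" using card_2_insertE[OF assms(2,4)] by blast
  have "a \<in> comp_of {b} u" using assms b by (intro comp_of_small) auto
  moreover have "comp_of {b} u \<subseteq> comp_of S u"
  proof (rule comp_of_closed)
    show "u \<in> comp_of S u" using assms(3) comp_of_refl by blast
    fix z w assume "z \<in> comp_of S u" "(z, w) \<in> parcs G" "w \<notin> {b}"
    then show "w \<in> comp_of S u" using no b comp_of_step[of z S u w] by blast
  qed
  ultimately show False using comp_of_subset assms(4) by blast
qed

lemma comp_of_attach: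
  assumes "S \<subseteq> pverts G" "card S = 2" "u \<in> pverts G - S" "a \<in> S" "a \<notin> R" "comp_of S u \<inter> R = {}"
  shows "a \<in> comp_of R u"
  using comp_of_touch[OF assms(1-4)] comp_of_avoid[OF assms(6)] comp_of_step assms(5) by blast

text \<open>A component of \<open>G - T\<close> that \<open>R\<close> misses is adjacent to both
  vertices of \<open>T\<close> and links them in \<open>G - R\<close>.\<close>

lemma not_splits_via_comp:
  assumes "T \<subseteq> pverts G" "card T = 2" "u \<in> pverts G - T" "comp_of T u \<inter> R = {}"
    "s \<in> T - R" "t \<in> T - R"
  shows "t \<in> comp_of R s"
  using comp_of_attach[of T u s R] comp_of_attach[of T u t R] assms comp_of_sym comp_of_trans by blast

lemma cuts_split_iff:
  assumes "R \<in> cutsets2 G" "T \<in> cutsets2 G"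
  shows "splits G R T \<longleftrightarrow> (\<exists>s\<in>T - R. \<exists>t\<in>T - R. t \<notin> comp_of R s)"
  using assms cutsets2D by (intro splits_iff) auto

lemma splitsE:
  assumes "R \<in> cutsets2 G" "T \<in> cutsets2 G" "splits G R T"
  obtains s t where "T = {s, t}" "s \<noteq> t" "s \<notin> R" "t \<notin> R" "t \<notin> comp_of R s" "R \<inter> T = {}"
proof -
  obtain s t where st: "s \<in> T - R" "t \<in> T - R" "t \<notin> comp_of R s"
    using assms cuts_split_iff by blast
  then have "s \<noteq> t" using comp_of_refl cutsets2D(1)[OF assms(2)] by blast
  moreover then have "T = {s, t}" using card_2_insertE[of T s] cutsets2D(2)[OF assms(2)] st by blast
  ultimately show ?thesis using that st by blast
qed

text \<open>If \<open>T\<close> did not split \<open>R\<close>, all of \<open>R\<close> would lie in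
  one component of \<open>G - T\<close>; another component would avoid \<open>R\<close> and link the
  vertices of \<open>T\<close> in \<open>G - R\<close>.\<close>

lemma splits_sym:
  assumes "R \<in> cutsets2 G" "T \<in> cutsets2 G" "splits G R T"
  shows "splits G T R"
proof (rule ccontr)
  assume no: "\<not> splits G T R"
  obtain s t where st: "T = {s, t}" "s \<noteq> t" "s \<notin> R" "t \<notin> R" "t \<notin> comp_of R s" "R \<inter> T = {}"
    by (rule splitsE[OF assms])
  obtain a where a: "a \<in> R" using cutsets2D(2)[OF assms(1)] by fastforce
  obtain u where u: "u \<in> pverts G - T" "u \<notin> comp_of T a"
    using comp_of_other[OF assms(2)] by blast
  have "comp_of T u \<inter> R = {}"
    using no a u st(6) comp_of_sym comp_of_trans cuts_split_iff[OF assms(2,1)] by blast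
  then have "t \<in> comp_of R s"
    using cutsets2D[OF assms(2)] u st by (intro not_splits_via_comp[of T u]) auto
  then show False using st by blast
qed

text \<open>Since \<open>T\<close> also splits \<open>R\<close>, no component of
  \<open>G - R\<close> may avoid \<open>T\<close>: it would link the vertices of \<open>R\<close> in
  \<open>G - T\<close>. So each component contains exactly one vertex of \<open>T\<close>.\<close>

lemma splits_comp_meets:
  assumes "R \<in> cutsets2 G" "T \<in> cutsets2 G" "splits G R T" "u \<in> pverts G - R"
  obtains s t where "T = {s, t}" "s \<noteq> t" "s \<in> comp_of R u" "t \<notin> comp_of R u" "R \<inter> T = {}"
proof -
  obtain s t where st: "T = {s, t}" "s \<noteq> t" "s \<notin> R" "t \<notin> R" "t \<notin> comp_of R s" "R \<inter> T = {}"
    by (rule splitsE[OF assms(1-3)])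
  obtain a b where ab: "R = {a, b}" "a \<noteq> b" "b \<notin> comp_of T a"
    using splitsE[OF assms(2,1) splits_sym[OF assms(1-3)]] by metis
  have "comp_of R u \<inter> T \<noteq> {}"
  proof
    assume "comp_of R u \<inter> T = {}"
    then have "b \<in> comp_of T a"
      using cutsets2D[OF assms(1)] assms(4) ab st(6) by (intro not_splits_via_comp[of R u]) auto
    then show False using ab by blast
  qed
  then consider "s \<in> comp_of R u" | "t \<in> comp_of R u" using st(1) by blast
  then show ?thesis
  proof cases
    case 1
    then have "t \<notin> comp_of R u" using st(5) comp_of_sym comp_of_trans by blast
    then show ?thesis using that 1 st by blast
  next
    case 2
    then have "s \<notin> comp_of R u" using st(5) comp_of_sym comp_of_trans by blast
    then show ?thesis using that[of t s] 2 st by (simp add: insert_commute)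
  qed
qed

lemma not_single_splits:
  assumes "R \<in> cutsets2 G" "R \<notin> single_cutsets G"
  obtains T where "T \<in> cutsets2 G" "splits G R T" "splits G T R"
  using assms splits_sym that unfolding single_cutsets_def independent_def by blast

lemma single_not_splits:
  assumes "S \<in> single_cutsets G" "T \<in> cutsets2 G"
  shows "\<not> splits G S T" "\<not> splits G T S"
proof -
  \<comment> \<open>Singleness speaks only of cutsets other than \<open>S\<close>, so the case
    \<open>T = S\<close> is checked apart.\<close>
  have "\<not> splits G S S"
    using cutsets2D single_in_cutsets2[OF assms(1)] by (subst splits_iff) auto
  then show "\<not> splits G S T" "\<not> splits G T S"
    using assms unfolding single_cutsets_def independent_def by auto
qed

lemma single_not_splitsD:
  assumes "S \<in> single_cutsets G" "T \<in> cutsets2 G"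
  shows "s \<in> T - S \<Longrightarrow> t \<in> T - S \<Longrightarrow> t \<in> comp_of S s"
    and "a \<in> S - T \<Longrightarrow> b \<in> S - T \<Longrightarrow> b \<in> comp_of T a"
  using single_not_splits[OF assms] assms(2) single_in_cutsets2[OF assms(1)] cuts_split_iff by blast+

text \<open>A walk leaving the quadrant of \<open>v\<close> must meet \<open>R\<close> or
  \<open>T\<close>. It cannot meet \<open>y\<close>, which lies beyond \<open>T\<close>, nor
  \<open>t\<close>, which lies beyond \<open>R\<close>; so \<open>{x, s}\<close> bounds the
  quadrant.\<close>

lemma corner_comp:
  assumes "R = {x, y}" "T = {s, t}" "y \<notin> T" "t \<notin> R" "y \<notin> comp_of T v" "t \<notin> comp_of R v"
    "v \<in> pverts G" "v \<notin> R" "v \<notin> T"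
  shows "comp_of {x, s} v \<subseteq> comp_of R v \<inter> comp_of T v"
proof (rule comp_of_closed)
  show "v \<in> comp_of R v \<inter> comp_of T v" using assms(7-9) comp_of_refl by blast
  fix z w assume z: "z \<in> comp_of R v \<inter> comp_of T v" "(z, w) \<in> parcs G" "w \<notin> {x, s}"
  have "w \<notin> R"
    using comp_of_step[of z T v w] z assms(1,3,5) by auto
  moreover have "w \<notin> T"
    using comp_of_step[of z R v w] z assms(2,4,6) by auto
  ultimately show "w \<in> comp_of R v \<inter> comp_of T v"
    using z comp_of_step by blast
qed

section \<open>Crossing cutsets\<close>

lemma finite_comp_of: "finite (comp_of R u)"
  by (rule finite_subset[OF _ finite_V]) (auto dest: comp_of_subset)

lemma card_comp_of_less: "comp_of R u \<subset> comp_of Q v \<Longrightarrow> card (comp_of R u) < card (comp_of Q v)"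
  by (rule psubset_card_mono[OF finite_comp_of])

text \<open>Among the cutsets separating \<open>b\<close> from \<open>x\<close>, one with the smallest component around \<open>x\<close> is single,
  since a cutset crossing it would give a corner cutset with a smaller component.\<close>

lemma single_separates_of_cut_separates:
  assumes x: "x \<in> pverts G" "\<And>R. R \<in> cutsets2 G \<Longrightarrow> x \<notin> R"
    and "Q \<in> cutsets2 G" "b \<in> pverts G" "b \<notin> Q" "b \<notin> comp_of Q x"
  obtains S where "S \<in> single_cutsets G" "b \<notin> S" "b \<notin> comp_of S x"
proof -
  let ?F = "\<lambda>Q. Q \<in> cutsets2 G \<and> b \<notin> Q \<and> b \<notin> comp_of Q x"
  have "?F Q" using assms by blast
  then obtain Q where Q: "?F Q" and min: "\<And>Q'. ?F Q' \<Longrightarrow> card (comp_of Q x) \<le> card (comp_of Q' x)"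
    using ex_has_least_nat[of ?F Q "\<lambda>Q. card (comp_of Q x)"] by blast
  have "Q \<in> single_cutsets G"
  proof (rule ccontr)
    assume "Q \<notin> single_cutsets G"
    then obtain T where T: "T \<in> cutsets2 G" "splits G Q T" "splits G T Q"
      using not_single_splits Q by blast
    have xQT: "x \<in> pverts G - Q" "x \<in> pverts G - T" using x Q T by auto
    obtain s t where st: "T = {s, t}" "s \<noteq> t" "s \<in> comp_of Q x" "t \<notin> comp_of Q x" "Q \<inter> T = {}"
      using splits_comp_meets[OF conjunct1[OF Q] T(1,2) xQT(1)] by metis
    obtain p q where pq: "Q = {p, q}" "p \<noteq> q" "p \<in> comp_of T x" "q \<notin> comp_of T x"
      using splits_comp_meets[OF T(1) conjunct1[OF Q] T(3) xQT(2)] by metis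
    have sub: "comp_of {p, s} x \<subseteq> comp_of Q x \<inter> comp_of T x"
      using xQT st pq by (intro corner_comp[of Q p q T s t]) auto
    have b: "b \<notin> {p, s}" "b \<notin> comp_of {p, s} x" using Q pq st sub by blast+
    have "{p, s} \<in> cutsets2 G"
      using b assms(4) xQT st pq comp_of_subset[OF pq(3)] comp_of_subset[OF st(3)]
      by (intro cutsets2I[of p s x b]) auto
    then have "card (comp_of Q x) \<le> card (comp_of {p, s} x)" using min b by blast
    \<comment> \<open>The inclusion is strict because \<open>s\<close> lies in the old component but
      is deleted at the corner.\<close>
    moreover have "comp_of {p, s} x \<subset> comp_of Q x"
      using sub st(3) comp_of_subset[of s "{p, s}" x] by blast
    ultimately show False using card_comp_of_less[of "{p, s}" x Q x] by linarith
  qed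
  then show ?thesis using that Q by blast
qed

text \<open>Every component of \<open>G - R\<close> contains one of the two vertices of a crossing
  cutset, so there are only two components.\<close>

lemma crossed_two_comps:
  assumes "R \<in> cutsets2 G" "R \<notin> single_cutsets G"
    and "a \<in> pverts G - R" "b \<in> pverts G - R" "c \<in> pverts G - R"
    and "b \<notin> comp_of R a" "c \<notin> comp_of R a"
  shows "c \<in> comp_of R b"
proof -
  obtain T where T: "T \<in> cutsets2 G" "splits G R T"
    using not_single_splits assms(1,2) by blast
  obtain s t where st: "T = {s, t}" by (rule splitsE[OF assms(1) T])
  have "s \<in> comp_of R u \<or> t \<in> comp_of R u" if "u \<in> pverts G - R" for u
    using splits_comp_meets[OF assms(1) T that] st by (metis insert_iff singletonD)
  then show ?thesis
    using assms(3-7) comp_of_eq[of s R] comp_of_eq[of t R] comp_of_refl[of _ R] by (metis DiffE)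
qed

text \<open>A crossing cutset separates \<open>x\<close> from \<open>y\<close>, which an edge
  between them would prevent.\<close>

lemma crossed_not_adjacent:
  assumes "{x, y} \<in> cutsets2 G" "{x, y} \<notin> single_cutsets G"
  shows "(x, y) \<notin> parcs G"
proof
  assume xy: "(x, y) \<in> parcs G"
  obtain T where T: "T \<in> cutsets2 G" "splits G T {x, y}"
    using not_single_splits assms by blast
  obtain p q where pq: "{x, y} = {p, q}" "p \<notin> T" "q \<notin> T" "q \<notin> comp_of T p"
    using splitsE[OF T(1) assms(1) T(2)] by metis
  have *: "p = x \<and> q = y \<or> p = y \<and> q = x" using pq(1) by (auto simp: doubleton_eq_iff)
  have "y \<in> comp_of T x"
    using comp_of_step[of x T x y] comp_of_refl[of x T] xy pq(2,3) * in_arcsD1[OF xy] by blast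
  then show False using * pq(4) comp_of_sym by blast
qed

abbreviation nbrs :: "'a \<Rightarrow> 'a set" where
  "nbrs x \<equiv> {y. (x, y) \<in> parcs G}"

text \<open>If a component of \<open>G - {x, y}\<close> contained two neighbours of \<open>x\<close>, then so would the smaller
  component at the corner \<open>{x, s}\<close>, because \<open>s\<close>, belonging to a crossed cutset with \<open>x\<close>, is not
  adjacent to \<open>x\<close>.\<close>

lemma crossed_comp_nbr_unique:
  assumes "\<And>S. S \<in> single_cutsets G \<Longrightarrow> x \<notin> S"
    and "{x, y} \<in> cutsets2 G" "p \<in> nbrs x" "q \<in> nbrs x" "q \<in> comp_of {x, y} p"
  shows "p = q"
  using assms(2-5)
proof (induction "card (comp_of {x, y} p)" arbitrary: y rule: less_induct)
  case less
  show ?case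
  proof (rule ccontr)
    assume "p \<noteq> q"
    let ?R = "{x, y}"
    note R = less.prems(1)
    have not_adj: "(x, z) \<notin> parcs G" if "{x, z} \<in> cutsets2 G" for z
      using crossed_not_adjacent[OF that] assms(1) by blast
    have p: "p \<in> pverts G - ?R" using less.prems(2) not_adj[OF R] in_arcsD2 no_loops' by blast
    obtain T where T: "T \<in> cutsets2 G" "splits G ?R T" "splits G T ?R"
      using not_single_splits[OF R] assms(1) by blast
    obtain s t where st: "T = {s, t}" "s \<noteq> t" "s \<in> comp_of ?R p" "t \<notin> comp_of ?R p" "?R \<inter> T = {}"
      using splits_comp_meets[OF R T(1,2) p] by metis
    have x: "x \<in> pverts G" "x \<notin> T" and y: "y \<in> pverts G" "y \<notin> T" "y \<noteq> x"
      using cutsets2D(1,2)[OF R] st(5) by auto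
    have xy_sep: "y \<notin> comp_of T x"
      using splitsE[OF T(1) R T(3)] comp_of_sym by (metis doubleton_eq_iff)
    \<comment> \<open>Meant for \<open>p\<close> and \<open>q\<close>: a neighbour \<open>v\<close>
      of \<open>x\<close> outside \<open>T\<close> lies on the side of \<open>x\<close> with respect
      to \<open>T\<close>, so \<open>y\<close> is beyond \<open>T\<close> and the corner
      \<open>{x, s}\<close> encloses \<open>v\<close>.\<close>
    have *: "v \<in> comp_of ?R p \<Longrightarrow> v \<in> nbrs x \<Longrightarrow> v \<noteq> s \<Longrightarrow>
      {x, s} \<in> cutsets2 G \<and> comp_of {x, s} v \<subseteq> comp_of ?R p \<and> y \<notin> comp_of {x, s} v" for v
    proof -
      assume v: "v \<in> comp_of ?R p" "v \<in> nbrs x" "v \<noteq> s"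
      have vV: "v \<in> pverts G" "v \<notin> ?R" using comp_of_subset[OF v(1)] by auto
      have vT: "v \<notin> T" using v st by auto
      have "x \<in> comp_of T v"
        using v(2) vV vT x comp_of_refl arcs_symmetric by (intro comp_of_step[of v T v x]) auto
      then have yT: "y \<notin> comp_of T v" using xy_sep comp_of_eq by blast
      have Rv: "comp_of ?R v = comp_of ?R p" using v(1) by (rule comp_of_eq)
      have sub: "comp_of {x, s} v \<subseteq> comp_of ?R v \<inter> comp_of T v"
        using st y vV vT yT Rv by (intro corner_comp[of ?R x y T s t]) auto
      have "{x, s} \<in> cutsets2 G"
        using x y st sub yT vV v(3) comp_of_subset[OF st(3)]
        by (intro cutsets2I[of x s v y]) auto
      then show ?thesis using sub Rv yT by blast
    qed
    have pp: "p \<in> comp_of ?R p" using p by (intro comp_of_refl) auto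
    \<comment> \<open>At least one of \<open>p\<close>, \<open>q\<close> differs from
      \<open>s\<close>, which makes the corner a cutset; then \<open>s\<close> is not adjacent to
      \<open>x\<close>, so both differ from \<open>s\<close>.\<close>
    have cut: "{x, s} \<in> cutsets2 G"
      using conjunct1[OF *[OF pp less.prems(2)]] conjunct1[OF *[OF less.prems(4,3)]] \<open>p \<noteq> q\<close> by metis
    then have "s \<notin> nbrs x" using not_adj by blast
    then have ps: "p \<noteq> s" "q \<noteq> s" using less.prems by auto
    have y': "y \<in> pverts G - {x, s}" using y st(1) by blast
    have pq': "p \<in> pverts G - {x, s}" "q \<in> pverts G - {x, s}"
      using p ps comp_of_subset[OF less.prems(4)] by auto
    have "y \<notin> comp_of {x, s} p" "y \<notin> comp_of {x, s} q"
      using *[OF pp less.prems(2) ps(1)] *[OF less.prems(4,3) ps(2)] by simp_all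
    then have "p \<notin> comp_of {x, s} y" "q \<notin> comp_of {x, s} y" using comp_of_sym by blast+
    \<comment> \<open>The corner leaves only two components, and neither \<open>p\<close> nor
      \<open>q\<close> lies in that of \<open>y\<close>.\<close>
    then have "q \<in> comp_of {x, s} p"
      using crossed_two_comps[OF cut _ y' pq'] assms(1) by blast
    moreover have "comp_of {x, s} p \<subset> comp_of ?R p"
      using *[OF pp less.prems(2) ps(1)] st(3) comp_of_subset[of s "{x, s}" p] by blast
    ultimately have "p = q"
      using less.hyps[OF card_comp_of_less cut less.prems(2,3)] by blast
    then show False using \<open>p \<noteq> q\<close> by blast
  qed
qed

text \<open>\<open>G - {x, y}\<close> has exactly two components, each holding exactly one neighbour
  of \<open>x\<close>, and \<open>x\<close> is not adjacent to \<open>y\<close>.\<close>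

lemma crossed_vertex_degree:
  assumes "\<And>S. S \<in> single_cutsets G \<Longrightarrow> x \<notin> S" "{x, y} \<in> cutsets2 G"
  obtains u v where "nbrs x = {u, v}" "u \<noteq> v" "u \<noteq> y" "v \<noteq> y"
proof -
  let ?R = "{x, y}"
  have R: "?R \<subseteq> pverts G" "card ?R = 2" using cutsets2D assms(2) by blast+
  obtain a b where ab: "a \<in> pverts G - ?R" "b \<in> pverts G - ?R" "b \<notin> comp_of ?R a"
    using assms(2) by (auto simp: cutsets2_iff)
  obtain u v where uv: "u \<in> comp_of ?R a" "(u, x) \<in> parcs G" "v \<in> comp_of ?R b" "(v, x) \<in> parcs G"
    using comp_of_touch[OF R ab(1), of x] comp_of_touch[OF R ab(2), of x] by blast
  have nonsingle: "?R \<notin> single_cutsets G" using assms(1) by blast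
  have "(x, y) \<notin> parcs G" using crossed_not_adjacent[OF assms(2) nonsingle] .
  have "w = u \<or> w = v" if "w \<in> nbrs x" for w
  proof -
    have w: "w \<in> pverts G - ?R"
      using that \<open>(x, y) \<notin> parcs G\<close> in_arcsD2 no_loops' by blast
    then consider "w \<in> comp_of ?R a" | "w \<in> comp_of ?R b"
      using crossed_two_comps[OF assms(2) nonsingle ab(1,2) w ab(3)] by blast
    then show ?thesis
    proof cases
      case 1
      then have "u \<in> comp_of ?R w" using uv(1) comp_of_eq by blast
      then show ?thesis
        using crossed_comp_nbr_unique[OF assms that] uv(2) arcs_symmetric by blast
    next
      case 2
      then have "v \<in> comp_of ?R w" using uv(3) comp_of_eq by blast
      then show ?thesis
        using crossed_comp_nbr_unique[OF assms that] uv(4) arcs_symmetric by blast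
    qed
  qed
  then have "nbrs x = {u, v}" using uv(2,4) arcs_symmetric by blast
  moreover have "u \<noteq> v" using uv(1,3) ab(2,3) comp_of_eq[of u ?R a] comp_of_eq[of v ?R b] comp_of_refl[of b ?R] by auto
  moreover have "u \<noteq> y" "v \<noteq> y" using comp_of_subset uv(1,3) by blast+
  ultimately show ?thesis using that by blast
qed

section \<open>Parts\<close>

lemma partD:
  assumes "A \<in> parts G"
  shows "A \<subseteq> pverts G"
    and "S \<in> single_cutsets G \<Longrightarrow> u \<in> A - S \<Longrightarrow> v \<in> A - S \<Longrightarrow> v \<in> comp_of S u"
    and "w \<in> pverts G - A \<Longrightarrow>
      \<exists>S\<in>single_cutsets G. w \<notin> S \<and> \<not> A \<subseteq> S \<and> comp_of S w \<inter> A = {}"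
proof -
  show A: "A \<subseteq> pverts G" using assms by (simp add: parts_def)
  show "v \<in> comp_of S u" if "S \<in> single_cutsets G" "u \<in> A - S" "v \<in> A - S"
    using that assms splits_iff[OF A cutsets2D(3)[OF single_in_cutsets2[OF that(1)]]]
    by (auto simp: parts_def)
  assume w: "w \<in> pverts G - A"
  moreover have "\<forall>w\<in>pverts G - A. \<exists>S\<in>single_cutsets G. separates G S {w} A"
    using assms by (simp add: parts_def)
  ultimately obtain S where S: "S \<in> single_cutsets G" "separates G S {w} A" by blast
  then have "w \<notin> S" "\<not> A \<subseteq> S" "\<And>y. y \<in> A \<Longrightarrow> y \<notin> S \<Longrightarrow> y \<notin> comp_of S w"
    using w by (simp_all add: separates_iff)
  then show "\<exists>S\<in>single_cutsets G. w \<notin> S \<and> \<not> A \<subseteq> S \<and> comp_of S w \<inter> A = {}"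
    using S(1) comp_of_subset by (intro bexI[of _ S]) auto
qed

lemma partI:
  assumes "A \<subseteq> pverts G"
    and "\<And>S u v. S \<in> single_cutsets G \<Longrightarrow> u \<in> A - S \<Longrightarrow> v \<in> A - S \<Longrightarrow> v \<in> comp_of S u"
    and "\<And>w. w \<in> pverts G - A \<Longrightarrow>
      \<exists>S\<in>single_cutsets G. w \<notin> S \<and> \<not> A \<subseteq> S \<and> comp_of S w \<inter> A = {}"
  shows "A \<in> parts G"
proof -
  have "\<not> splits G S A" if "S \<in> single_cutsets G" for S
    using splits_iff[OF assms(1) cutsets2D(3)[OF single_in_cutsets2[OF that]]] assms(2)[OF that]
    by blast
  moreover have "\<exists>S\<in>single_cutsets G. separates G S {w} A" if "w \<in> pverts G - A" for w
  proof -
    obtain S where "S \<in> single_cutsets G" "w \<notin> S" "\<not> A \<subseteq> S" "comp_of S w \<inter> A = {}"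
      using assms(3)[OF \<open>w \<in> _\<close>] by blast
    then show ?thesis using that by (intro bexI[of _ S]) (auto simp: separates_iff)
  qed
  ultimately show ?thesis using assms(1) by (auto simp: parts_def)
qed

text \<open>Take a cutset separating \<open>w\<close> from the part with the largest component around \<open>w\<close>: one having
  a vertex \<open>a\<close> outside the part could be replaced by a cutset separating \<open>a\<close> from the part.\<close>

lemma part_boundary:
  assumes A: "A \<in> parts G" and w: "w \<in> pverts G - A"
  obtains S where "S \<in> single_cutsets G" "S \<subset> A" "w \<notin> S" "comp_of S w \<inter> A = {}"
proof -
  let ?F = "\<lambda>S. S \<in> single_cutsets G \<and> w \<notin> S \<and> \<not> A \<subseteq> S \<and> comp_of S w \<inter> A = {}"
  obtain S0 where S0: "?F S0" using partD(3)[OF A w] by blast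
  have bound: "card (comp_of S w) \<le> card (pverts G)" for S
    using comp_of_subset by (intro card_mono finite_V) blast
  have "\<exists>S. ?F S \<and> (\<forall>S'. ?F S' \<longrightarrow> card (comp_of S' w) \<le> card (comp_of S w))"
    by (rule ex_has_greatest_nat[of ?F S0 _ "Suc (card (pverts G))"])
      (use S0 bound in \<open>simp_all add: le_imp_less_Suc\<close>)
  then obtain S where S: "?F S"
    and max: "\<And>S'. ?F S' \<Longrightarrow> card (comp_of S' w) \<le> card (comp_of S w)"
    by blast
  have cut: "S \<in> cutsets2 G" using S single_in_cutsets2 by blast
  note SV = cutsets2D(1,2)[OF cut]
  have "S \<subseteq> A"
  proof
    fix a assume a: "a \<in> S"
    show "a \<in> A"
    proof (rule ccontr)
      assume "a \<notin> A"
      then obtain S' where S': "S' \<in> single_cutsets G" "a \<notin> S'" "\<not> A \<subseteq> S'" "comp_of S' a \<inter> A = {}"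
        using partD(3)[OF A, of a] a SV by blast
      obtain z where z: "z \<in> A" "z \<notin> S" using S by blast
      have zV: "z \<in> pverts G - S" using z partD(1)[OF A] by blast
      \<comment> \<open>If \<open>S'\<close> met the component of \<open>w\<close>, it would miss
        that of \<open>z\<close>, since \<open>S\<close> does not split \<open>S'\<close>. Then
        \<open>a\<close> would be linked to \<open>z\<close> in \<open>G - S'\<close>, although
        \<open>S'\<close> separates \<open>a\<close> from \<open>A\<close>.\<close>
      have "comp_of S w \<inter> S' = {}"
      proof (rule ccontr)
        assume "comp_of S w \<inter> S' \<noteq> {}"
        then obtain s where s: "s \<in> S'" "s \<in> comp_of S w" by blast
        have "comp_of S z \<inter> S' = {}"
        proof (rule ccontr)
          assume "comp_of S z \<inter> S' \<noteq> {}"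
          then obtain t where t: "t \<in> S'" "t \<in> comp_of S z" by blast
          then have "t \<in> comp_of S s"
            using single_not_splitsD(1)[of S S' s t] S single_in_cutsets2[OF S'(1)] s comp_of_subset
            by blast
          then have "z \<in> comp_of S w"
            using s t comp_of_eq[of s S w] comp_of_eq[of t S w] comp_of_sym[of t S z] by blast
          then show False using S z by blast
        qed
        then have "a \<in> comp_of S' z"
          using comp_of_attach[OF SV zV a S'(2)] by blast
        then show False using S'(4) z comp_of_sym by blast
      qed
      \<comment> \<open>So \<open>S'\<close> leaves the component of \<open>w\<close> intact and
        adds \<open>a\<close> to it, contradicting maximality.\<close>
      moreover from this have "a \<in> comp_of S' w"
        using comp_of_attach[OF SV _ a S'(2)] w S by blast
      moreover have "w \<notin> S'"
        using calculation(1) comp_of_refl w S by blast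
      ultimately have "?F S'" "comp_of S w \<subset> comp_of S' w"
        using S' comp_of_eq[of a S' w] comp_of_avoid[of S w S'] a comp_of_subset[of a S w] by blast+
      then show False
        using max[of S'] card_comp_of_less[of S w S' w] by linarith
    qed
  qed
  then show ?thesis using that S by blast
qed

text \<open>An interior vertex avoids all single cutsets, so it is a reference point that determines
  its part.\<close>

lemma part_interior_mem_iff:
  assumes "A \<in> parts G" "x \<in> part_interior G A" "w \<in> pverts G"
  shows "w \<in> A \<longleftrightarrow> (\<forall>S\<in>single_cutsets G. w \<in> S \<or> w \<in> comp_of S x)"
proof
  show "w \<in> A \<Longrightarrow> \<forall>S\<in>single_cutsets G. w \<in> S \<or> w \<in> comp_of S x"
    using partD(2)[OF assms(1), of _ x w] assms(2) by (auto simp: part_interior_def)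
  show "\<forall>S\<in>single_cutsets G. w \<in> S \<or> w \<in> comp_of S x \<Longrightarrow> w \<in> A"
    using partD(3)[OF assms(1), of w] comp_of_sym[of w _ x] assms(2,3)
    by (auto simp: part_interior_def)
qed

lemma part_interior_nbr:
  assumes "A \<in> parts G" "x \<in> part_interior G A" "(x, w) \<in> parcs G"
  shows "w \<in> A"
proof -
  have "w \<in> S \<or> w \<in> comp_of S x" if "S \<in> single_cutsets G" for S
    using that assms(2,3) comp_of_step[of x S x w] comp_of_refl[of x S] in_arcsD1
    by (auto simp: part_interior_def)
  then show ?thesis using part_interior_mem_iff assms in_arcsD2 by blast
qed

text \<open>A single cutset misses \<open>x\<close> and does not split \<open>{x, y}\<close>, so it
  cannot separate \<open>y\<close> from \<open>x\<close>.\<close>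

lemma part_interior_cut:
  assumes "A \<in> parts G" "x \<in> part_interior G A" "{x, y} \<in> cutsets2 G"
  shows "y \<in> A"
proof -
  have "y \<in> S \<or> y \<in> comp_of S x" if "S \<in> single_cutsets G" for S
    using single_not_splitsD(1)[OF that assms(3), of x y] assms(2) that
    by (auto simp: part_interior_def)
  then show ?thesis
    using part_interior_mem_iff[OF assms(1,2), of y] cutsets2D(1)[OF assms(3)] by blast
qed

lemma ex_part_interior:
  assumes "x \<in> pverts G" "\<And>S. S \<in> single_cutsets G \<Longrightarrow> x \<notin> S"
  obtains A where "A \<in> parts G" "x \<in> part_interior G A"
proof -
  \<comment> \<open>The only possible choice, by \<open>part_interior_mem_iff\<close>.\<close>
  let ?A = "{w \<in> pverts G. \<forall>S\<in>single_cutsets G. w \<in> S \<or> w \<in> comp_of S x}"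
  have x: "x \<in> ?A" using assms comp_of_refl by blast
  have "?A \<in> parts G"
  proof (rule partI)
    fix S u v assume "S \<in> single_cutsets G" "u \<in> ?A - S" "v \<in> ?A - S"
    then have "u \<in> comp_of S x" "v \<in> comp_of S x" by blast+
    then show "v \<in> comp_of S u" using comp_of_trans comp_of_sym by blast
  next
    fix w assume "w \<in> pverts G - ?A"
    then obtain S where S: "S \<in> single_cutsets G" "w \<notin> S" "w \<notin> comp_of S x" by blast
    have "comp_of S w \<inter> ?A = {}"
    proof (rule ccontr)
      assume "comp_of S w \<inter> ?A \<noteq> {}"
      then obtain v where "v \<in> comp_of S w" "v \<in> comp_of S x" using S(1) comp_of_subset by blast
      then show False using S(3) comp_of_trans[of v S x w] comp_of_sym[of v S w] by blast
    qed
    then show "\<exists>S\<in>single_cutsets G. w \<notin> S \<and> \<not> ?A \<subseteq> S \<and> comp_of S w \<inter> ?A = {}"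
      using S x assms(2) by blast
  qed blast
  then show ?thesis using that x assms(2) by (auto simp: part_interior_def)
qed

section \<open>The graph \<open>G'\<close> restricted to a part\<close>

abbreviation parcs' :: "'a rel" where
  "parcs' \<equiv> parcs (add_cutset_edges G)"

lemma in_parcs'_iff: "(u, v) \<in> parcs' \<longleftrightarrow> (u, v) \<in> parcs G \<or> {u, v} \<in> single_cutsets G"
  by (simp add: add_cutset_edges_def)

lemma sym_parcs': "sym parcs'"
  using arcs_symmetric by (auto simp: in_parcs'_iff insert_commute intro!: symI)

text \<open>An excursion of a walk outside \<open>A\<close> leaves and returns through the same
  single cutset, so an edge of \<open>G'\<close> can replace it. Connections in \<open>G - R\<close>
  between vertices of \<open>A\<close> thus persist in \<open>G'\<close> inside
  \<open>A - R\<close>.\<close>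

lemma part_reachable:
  assumes A: "A \<in> parts G" and u: "u \<in> A - R" and v: "v \<in> comp_of R u" "v \<in> A"
  shows "(u, v) \<in> rtrancl_on (A - R) parcs'"
proof -
  let ?reach = "\<lambda>z. (u, z) \<in> rtrancl_on (A - R) parcs'"
  \<comment> \<open>While the walk is outside \<open>A\<close>, \<open>S\<close> is the cutset through which it left; it can only come back
    through \<open>S\<close>, whose two vertices are adjacent in \<open>G'\<close>.\<close>
  let ?P = "\<lambda>z. if z \<in> A then ?reach z else \<exists>S\<in>single_cutsets G. S \<subseteq> A \<and> z \<notin> S \<and>
    comp_of S z \<inter> A = {} \<and> (\<exists>s\<in>S - R. ?reach s)"
  have "(u, v) \<in> rtrancl_on (pverts G - R) (parcs G)" using v by (simp add: comp_of_def)
  then have "?P v"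
  proof (induct rule: rtrancl_on_induct)
    case base
    then show ?case using u by auto
  next
    case (step y z)
    show ?case
    proof (cases "y \<in> A")
      case y: True
      show ?thesis
      proof (cases "z \<in> A")
        case True
        then show ?thesis
          using step y by (auto simp: in_parcs'_iff intro: rtrancl_on_into_rtrancl_on)
      next
        case False
        then obtain S where S: "S \<in> single_cutsets G" "S \<subset> A" "z \<notin> S" "comp_of S z \<inter> A = {}"
          using part_boundary[OF A, of z] step by blast
        have "y \<in> S"
          using S(3,4) comp_of_step[of z S z y] comp_of_refl[of z S] step arcs_symmetric y by blast
        then have "\<exists>s\<in>S - R. ?reach s" using step y by auto
        then show ?thesis using S False by auto
      qed
    next
      case y: False
      then obtain S s where S: "S \<in> single_cutsets G" "S \<subseteq> A" "y \<notin> S" "comp_of S y \<inter> A = {}"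
        and s: "s \<in> S - R" "?reach s"
        using step by auto
      show ?thesis
      proof (cases "z \<in> A")
        case True
        have "z \<in> S"
          using S(3,4) comp_of_step[of y S y z] comp_of_refl[of y S] step True by blast
        have "?reach z"
        \<comment> \<open>Returning to the vertex of departure needs no edge; otherwise
          \<open>z\<close> is the other vertex of \<open>S\<close>, and \<open>S\<close> is an edge
          of \<open>G'\<close>.\<close>
        proof (cases "z = s")
          case False
          then have "S = {s, z}"
            using card_2_insertE[of S s] cutsets2D(2)[OF single_in_cutsets2[OF S(1)]] s(1) \<open>z \<in> S\<close>
            by blast
          then have "(s, z) \<in> parcs'" using S(1) by (simp add: in_parcs'_iff)
          then show ?thesis
            using s(2) True step by (auto intro: rtrancl_on_into_rtrancl_on)
        qed (use s in simp)
        then show ?thesis using True by simp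
      next
        case False
        have "z \<in> comp_of S y"
          using comp_of_step[of y S y z] comp_of_refl[of y S] step S False by blast
        then have "z \<notin> S" "comp_of S z = comp_of S y"
          using comp_of_subset[of z S y] comp_of_eq[of z S y] by auto
        then show ?thesis using S s False by auto
      qed
    qed
  qed
  then show ?thesis using v by simp
qed

lemma part_connected:
  assumes "A \<in> parts G" "\<And>u v. u \<in> A - R \<Longrightarrow> v \<in> A - R \<Longrightarrow> v \<in> comp_of R u" "A - R \<noteq> {}"
  shows "connected (del_verts (add_cutset_edges G \<restriction> A) R)"
  unfolding del_verts_induce connected_induce_iff[OF sym_parcs']
  by (intro conjI ballI assms(3) part_reachable[OF assms(1)]) (use assms(2) in auto)

section \<open>Critical graphs\<close>

text \<open>Adding \<open>x\<close> turns a cutset of \<open>G - x\<close> with at most one vertex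
  into a cutset of \<open>G\<close> with at most two, hence exactly two, vertices; removing
  \<open>x\<close> goes back.\<close>

lemma biconnected_del_vert_iff:
  assumes "card (pverts G) \<ge> 4" "x \<in> pverts G"
  shows "biconnected (del_verts G {x}) \<longleftrightarrow> (\<forall>R\<in>cutsets2 G. x \<notin> R)"
proof -
  have cut: "cutset (del_verts G {x}) R \<longleftrightarrow> R \<subseteq> pverts G - {x} \<and> \<not> connected (del_verts G (insert x R))" for R
  proof -
    have "del_verts (del_verts (with_proj G) {x}) R = del_verts G (insert x R)"
      unfolding del_verts_def[of G "{x}"] del_verts_induce
      by (simp add: del_verts_def Diff_insert2[of "pverts G" x R])
    moreover have "verts (del_verts (with_proj G) {x}) = pverts G - {x}"
      by (simp add: del_verts_def)
    ultimately show ?thesis by (simp add: cutset_def)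
  qed
  have verts: "card (verts (del_verts G {x})) > 2"
    using assms finite_V by (simp add: del_verts_def)
  have "(\<exists>R. cutset (del_verts G {x}) R \<and> card R < 2) \<longleftrightarrow> (\<exists>R\<in>cutsets2 G. x \<in> R)"
  proof
    assume "\<exists>R. cutset (del_verts G {x}) R \<and> card R < 2"
    then obtain R where R: "R \<subseteq> pverts G - {x}" "\<not> connected (del_verts G (insert x R))" "card R < 2"
      using cut by blast
    then have "cutset G (insert x R)" "card (insert x R) \<le> 2"
      using assms(2) finite_V by (auto simp: cutset_def card_insert_if finite_subset)
    moreover then have "card (insert x R) = 2"
      using biconnected by (metis k_connected_def le_neq_implies_less)
    ultimately show "\<exists>R\<in>cutsets2 G. x \<in> R" unfolding cutsets2_def by blast
  next
    assume "\<exists>R\<in>cutsets2 G. x \<in> R"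
    then obtain R where R: "R \<in> cutsets2 G" "x \<in> R" by blast
    then have "cutset (del_verts G {x}) (R - {x})"
      using cut by (auto simp: cutsets2_def cutset_def insert_absorb)
    moreover have "card (R - {x}) < 2" using cutsets2D[OF R(1)] R(2) by simp
    ultimately show "\<exists>R. cutset (del_verts G {x}) R \<and> card R < 2" by blast
  qed
  then show ?thesis using verts by (auto simp: k_connected_def)
qed

lemma critical_iff:
  "critical G \<longleftrightarrow> card (pverts G) \<ge> 4 \<and> (\<forall>x\<in>pverts G. \<exists>y. {x, y} \<in> cutsets2 G)"
proof -
  have "(\<exists>R\<in>cutsets2 G. x \<in> R) \<longleftrightarrow> (\<exists>y. {x, y} \<in> cutsets2 G)" for x
    using card_2_insertE cutsets2D(2) by (metis insertI1)
  then have "\<not> biconnected (del_verts G {x}) \<longleftrightarrow> (\<exists>y. {x, y} \<in> cutsets2 G)"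
    if "card (pverts G) \<ge> 4" "x \<in> pverts G" for x
    using biconnected_del_vert_iff[OF that] by blast
  then show ?thesis using biconnected by (auto simp: critical_def)
qed

end

section \<open>Recognizing cycles\<close>

lemma in_symcl_iff: "(p, q) \<in> symcl r \<longleftrightarrow> (p, q) \<in> r \<or> (q, p) \<in> r"
  by (force simp: symcl_def)

lemma card2_eqI:
  assumes "card X = 2" "p \<in> X" "q \<in> X" "p \<noteq> q"
  shows "X = {p, q}"
  using card_2_insertE[OF assms(1,2)] assms(3,4) by (metis insertE singletonD)

text \<open>Take a longest path from \<open>a\<close> through \<open>A - {a, b}\<close>. The second
  neighbour \<open>w\<close> of its end is neither on the path nor able to extend it, so it is
  \<open>a\<close> or \<open>b\<close>. The path is closed under adjacency outside \<open>a\<close>,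
  \<open>b\<close>, hence exhausts \<open>A - {a, b}\<close>; a neighbour of \<open>b\<close> there
  forces \<open>w = b\<close>, and the edge \<open>ab\<close> closes the cycle.\<close>

lemma cycle_list_exists:
  assumes fin: "finite A" and r: "r \<subseteq> A \<times> A" "sym r" "irrefl r"
    and ab: "a \<in> A" "b \<in> A" "a \<noteq> b" "(a, b) \<in> r"
    and deg: "\<And>x. x \<in> A - {a, b} \<Longrightarrow> card {y. (x, y) \<in> r} = 2"
    and conn: "\<And>u v. u \<in> A - {a, b} \<Longrightarrow> v \<in> A - {a, b} \<Longrightarrow> (u, v) \<in> rtrancl_on (A - {a, b}) r"
    and a_nbr: "\<exists>y\<in>A - {a, b}. (a, y) \<in> r" and b_nbr: "\<exists>y\<in>A - {a, b}. (b, y) \<in> r"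
  shows "\<exists>vs. distinct vs \<and> length vs \<ge> 3 \<and> set vs = A \<and>
    r = symcl {(vs ! i, vs ! (Suc i mod length vs)) | i. i < length vs}"
proof -
  define M where "M = A - {a, b}"
  \<comment> \<open>\<open>ps\<close> omits the start \<open>a\<close>, so
    \<open>(a # ps) ! i\<close> is the predecessor of \<open>ps ! i\<close>; in
    \<open>L = a # ps\<close> below, the last index is \<open>k\<close>.\<close>
  define path where "path ps \<longleftrightarrow> ps \<noteq> [] \<and> distinct ps \<and> set ps \<subseteq> M \<and>
    (\<forall>i<length ps. ((a # ps) ! i, ps ! i) \<in> r)" for ps
  have symr: "(y, x) \<in> r" if "(x, y) \<in> r" for x y using r(2) that by (rule symD)
  obtain y0 where "y0 \<in> M" "(a, y0) \<in> r" using a_nbr M_def by blast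
  then have "path [y0]" by (simp add: path_def)
  moreover have "length ps < Suc (card M)" if "path ps" for ps
    using that fin distinct_card[of ps] card_mono[of M "set ps"] by (auto simp: path_def M_def)
  ultimately have "\<exists>ps. path ps \<and> (\<forall>qs. path qs \<longrightarrow> length qs \<le> length ps)"
    by (intro ex_has_greatest_nat) auto
  then obtain ps where ps: "path ps" and max: "\<And>qs. path qs \<Longrightarrow> length qs \<le> length ps"
    by blast
  define k where "k = length ps"
  define L where "L = a # ps"
  have k: "k > 0" using ps by (simp add: path_def k_def)
  have L_len: "length L = Suc k" by (simp add: L_def k_def)
  have L_dist: "distinct L" using ps by (auto simp: L_def path_def M_def)
  have L_adj: "(L ! i, L ! Suc i) \<in> r" if "i < k" for i
    using ps that by (simp add: L_def path_def k_def)
  have L_M: "L ! i \<in> M" if "0 < i" "i \<le> k" for i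
    using ps that by (cases i) (auto simp: L_def path_def k_def)
  have L_eq: "L ! i = L ! j \<longleftrightarrow> i = j" if "i \<le> k" "j \<le> k" for i j
    using nth_eq_iff_index_eq[OF L_dist] that by (simp add: L_len)
  have inner: "{y. (L ! i, y) \<in> r} = {L ! (i - 1), L ! Suc i}" if "0 < i" "i < k" for i
  proof (rule card2_eqI)
    show "card {y. (L ! i, y) \<in> r} = 2" using deg L_M that M_def by simp
    show "L ! (i - 1) \<in> {y. (L ! i, y) \<in> r}"
      using L_adj[of "i - 1"] that symr by simp
    show "L ! Suc i \<in> {y. (L ! i, y) \<in> r}" using L_adj that by simp
    show "L ! (i - 1) \<noteq> L ! Suc i" using L_eq[of "i - 1" "Suc i"] that by simp
  qed
  have "card {y. (L ! k, y) \<in> r} = 2" using deg L_M k M_def by simp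
  moreover have "L ! (k - 1) \<in> {y. (L ! k, y) \<in> r}"
    using L_adj[of "k - 1"] k symr by simp
  ultimately obtain w where w: "{y. (L ! k, y) \<in> r} = {L ! (k - 1), w}" "L ! (k - 1) \<noteq> w"
    by (rule card_2_insertE)
  have wr: "(L ! k, w) \<in> r" using w by blast
  have ps_nth: "\<exists>j<k. x = L ! Suc j" if "x \<in> set ps" for x
    using that unfolding in_set_conv_nth by (auto simp: L_def k_def)
  \<comment> \<open>A path vertex before the end is adjacent only to its path neighbours, so
    \<open>w\<close> would be \<open>L ! (k - 1)\<close>, which is excluded.\<close>
  have "w \<notin> set ps"
  proof
    assume "w \<in> set ps"
    then obtain j where j: "j < k" "w = L ! Suc j" using ps_nth by blast
    then have "Suc j \<noteq> k" using wr r(3) by (auto simp: irrefl_def)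
    then have "L ! k \<in> {L ! j, L ! Suc (Suc j)}"
      using inner[of "Suc j"] symr[OF wr] j by auto
    then have "k = Suc (Suc j)" using L_eq[of k j] L_eq[of k "Suc (Suc j)"] j \<open>Suc j \<noteq> k\<close> by auto
    then show False using w(2) j by simp
  qed
  have "w \<notin> M"
  proof
    assume "w \<in> M"
    have "path (ps @ [w])"
      unfolding path_def
    proof (intro conjI allI impI)
      fix i assume "i < length (ps @ [w])"
      then consider "i < k" | "i = k" by (auto simp: k_def less_Suc_eq)
      then show "((a # ps @ [w]) ! i, (ps @ [w]) ! i) \<in> r"
      proof cases
        case 1
        then have "(a # ps @ [w]) ! i = L ! i" "(ps @ [w]) ! i = L ! Suc i"
          by (simp_all add: L_def k_def nth_append nth_Cons split: nat.split)
        then show ?thesis using L_adj 1 by simp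
      next
        case 2
        then have "(a # ps @ [w]) ! i = L ! k" "(ps @ [w]) ! i = w"
          using k by (simp_all add: L_def k_def nth_append nth_Cons split: nat.split)
        then show ?thesis using wr by simp
      qed
    qed (use ps \<open>w \<in> M\<close> \<open>w \<notin> set ps\<close> in \<open>auto simp: path_def\<close>)
    then show False using max by fastforce
  qed
  then have w_ab: "w = a \<or> w = b" using wr r(1) M_def by blast
  have nbrs_ps: "y \<in> set L \<or> y = w" if xy: "x \<in> set ps" "(x, y) \<in> r" for x y
  proof -
    obtain j where j: "j < k" "x = L ! Suc j" using ps_nth xy(1) by blast
    show ?thesis
    proof (cases "Suc j = k")
      case True
      then have "y = L ! j \<or> y = w" using w(1) xy(2) j(2) by auto
      moreover have "L ! j \<in> set L" using j(1) L_len by simp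
      ultimately show ?thesis by auto
    next
      case False
      then have "y = L ! j \<or> y = L ! Suc (Suc j)" using inner[of "Suc j"] xy(2) j by auto
      moreover have "L ! j \<in> set L" "L ! Suc (Suc j) \<in> set L"
        using j(1) False L_len by simp_all
      ultimately show ?thesis by auto
    qed
  qed
  have ps_M: "set ps = M"
  proof
    show "set ps \<subseteq> M" using ps by (simp add: path_def)
    show "M \<subseteq> set ps"
    proof
      fix v assume v: "v \<in> M"
      have "ps ! 0 \<in> set ps" using k by (simp add: k_def)
      then have "(ps ! 0, v) \<in> rtrancl_on (A - {a, b}) r"
        using conn v \<open>set ps \<subseteq> M\<close> M_def by blast
      then show "v \<in> set ps"
      proof (induct rule: rtrancl_on_induct)
        case base
        then show ?case using k by (simp add: k_def)
      next
        case (step y z)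
        then have "z \<in> set L \<or> z = w" using nbrs_ps by blast
        then show ?case using step(4) w_ab by (auto simp: L_def)
      qed
    qed
  qed
  have "w = b"
  proof (rule ccontr)
    assume "w \<noteq> b"
    obtain y where "y \<in> M" "(y, b) \<in> r" using b_nbr symr M_def by blast
    then have "b \<in> set L" using nbrs_ps ps_M \<open>w \<noteq> b\<close> by blast
    then show False using ps_M ab M_def by (simp add: L_def)
  qed
  define vs where "vs = L @ [b]"
  define n where "n = length vs"
  have n: "n = Suc (Suc k)" by (simp add: n_def vs_def L_len)
  have vs_L: "vs ! i = L ! i" if "i \<le> k" for i using that by (simp add: vs_def nth_append L_len)
  have vs_b: "vs ! Suc k = b" by (simp add: vs_def nth_append L_len)
  have vs_a: "vs ! 0 = a" by (simp add: vs_def L_def)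
  have set_vs: "set vs = A" using ps_M ab by (auto simp: vs_def L_def M_def)
  have "distinct vs" using L_dist ps_M ab by (auto simp: vs_def L_def M_def)
  let ?R = "{(vs ! i, vs ! (Suc i mod n)) | i. i < n}"
  have in_R: "(vs ! i, vs ! Suc i) \<in> ?R" if "i \<le> k" for i
    using that n by (intro CollectI exI[of _ i]) auto
  \<comment> \<open>The wrap-around pair: \<open>Suc k\<close> is the last index of
    \<open>vs\<close>, and its successor modulo \<open>n\<close> is 0.\<close>
  have ba_R: "(b, a) \<in> ?R"
    using n vs_a vs_b by (intro CollectI exI[of _ "Suc k"]) auto
  have M_R: "(p, q) \<in> ?R \<or> (q, p) \<in> ?R" if pq: "p \<in> M" "(p, q) \<in> r" for p q
  proof -
    obtain j where j: "j < k" "p = L ! Suc j"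
      using ps_nth pq(1) ps_M by blast
    have "q = vs ! j \<or> q = vs ! Suc (Suc j)"
    proof (cases "Suc j = k")
      case True
      then show ?thesis using w(1) that(2) j \<open>w = b\<close> vs_b vs_L[of j] by auto
    next
      case False
      then show ?thesis
        using inner[of "Suc j"] that(2) j vs_L[of j] vs_L[of "Suc (Suc j)"] by auto
    qed
    moreover have "p = vs ! Suc j" using j vs_L[of "Suc j"] by simp
    ultimately show ?thesis using in_R[of j] in_R[of "Suc j"] j(1) by auto
  qed
  have "r = symcl ?R"
  proof (intro set_eqI iffI; clarify)
    fix p q assume pq: "(p, q) \<in> r"
    have "p \<noteq> q" using pq r(3) by (auto simp: irrefl_def)
    have "p \<in> M \<or> q \<in> M \<or> {p, q} \<subseteq> {a, b}" using pq r(1) M_def by blast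
    then have "(p, q) \<in> ?R \<or> (q, p) \<in> ?R"
      using M_R[of p q] M_R[of q p] pq symr ba_R \<open>p \<noteq> q\<close> by auto
    then show "(p, q) \<in> symcl ?R" unfolding in_symcl_iff .
  next
    fix p q assume "(p, q) \<in> symcl ?R"
    then have "(p, q) \<in> ?R \<or> (q, p) \<in> ?R" unfolding in_symcl_iff .
    moreover have "(p, q) \<in> r" if pq: "(p, q) \<in> ?R" for p q
    proof -
      obtain i where i: "i < n" "p = vs ! i" "q = vs ! (Suc i mod n)" using pq by blast
      then consider "i < k" | "i = k" | "i = Suc k" using n by linarith
      then show ?thesis
      proof cases
        case 1
        then show ?thesis using i n L_adj vs_L by simp
      next
        case 2
        then show ?thesis using i n wr \<open>w = b\<close> vs_b vs_L by simp
      next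
        case 3
        then show ?thesis using i n vs_a vs_b ab(4) symr by simp
      qed
    qed
    ultimately show "(p, q) \<in> r" using symr by blast
  qed
  then show ?thesis
    using \<open>distinct vs\<close> set_vs n k n_def by (intro exI[of _ vs]) auto
qed

section \<open>Adjacency in \<open>G'\<close>, neighbours and the number of vertices\<close>

context biconnected_graph
begin

lemma arcs_ends_part: "arcs_ends (add_cutset_edges G \<restriction> A) = parcs' \<inter> A \<times> A"
  by (auto simp: arcs_ends_conv)

lemma irrefl_parcs': "(u, u) \<notin> parcs'"
proof
  assume "(u, u) \<in> parcs'"
  then have "{u, u} \<in> single_cutsets G" using no_loops' by (auto simp: in_parcs'_iff)
  then show False using cutsets2D(2)[OF single_in_cutsets2] by fastforce
qed

lemma cutsets2_pair_distinct: "{x, y} \<in> cutsets2 G \<Longrightarrow> x \<noteq> y"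
  using cutsets2D(2) by fastforce

text \<open>A component of \<open>G - {x, w}\<close> is adjacent to \<open>x\<close>, so
  \<open>x\<close> has a neighbour other than \<open>w\<close>; this is applied first to any
  \<open>w\<close>, then to the neighbour found.\<close>

lemma two_nbrs:
  assumes "x \<in> pverts G"
  obtains u v where "u \<in> nbrs x" "v \<in> nbrs x" "u \<noteq> v"
proof -
  have other: "\<exists>u\<in>nbrs x. u \<noteq> w" if w: "w \<in> pverts G" "w \<noteq> x" for w
  proof -
    have c: "card {x, w} = 2" using w by simp
    then obtain z where "z \<in> pverts G - {x, w}" using ex_vert_not_in[of "{x, w}"] by auto
    then obtain u where "u \<in> comp_of {x, w} z" "(u, x) \<in> parcs G"
      using comp_of_touch[OF _ c, of z x] assms w by blast
    then show ?thesis using comp_of_subset[of u "{x, w}" z] arcs_symmetric by blast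
  qed
  obtain w where "w \<in> pverts G" "w \<noteq> x" using ex_vert_not_in[of "{x}"] by auto
  then obtain u where u: "u \<in> nbrs x" using other by blast
  then obtain v where "v \<in> nbrs x" "v \<noteq> u" using other[of u] in_arcsD2 no_loops' by blast
  then show ?thesis using that u by blast
qed

lemma card_verts_of_cut:
  assumes "R \<in> cutsets2 G"
  shows "card (pverts G) \<ge> 4"
proof -
  obtain u v where uv: "u \<in> pverts G - R" "v \<in> pverts G - R" "v \<notin> comp_of R u"
    using assms by (auto simp: cutsets2_iff)
  then have "u \<noteq> v" using comp_of_refl by blast
  note R = cutsets2D[OF assms]
  have "card (R \<union> {u, v}) = card R + card {u, v}"
    using uv R by (intro card_Un_disjoint) auto
  moreover have "card (R \<union> {u, v}) \<le> card (pverts G)"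
    using uv R by (intro card_mono finite_V) auto
  ultimately show ?thesis using R(2) \<open>u \<noteq> v\<close> by simp
qed

section \<open>Blocks and triangles\<close>

text \<open>The two neighbours \<open>u\<close>, \<open>v\<close> of \<open>x\<close> and its
  partner \<open>y\<close> all lie in \<open>A\<close>. As \<open>x\<close> is in no single cutset,
  it gains no edges in \<open>G'\<close>, so \<open>{u, v}\<close> isolates \<open>x\<close> from
  \<open>y\<close> there.\<close>

lemma crossed_interior_part:
  assumes A: "A \<in> parts G" and x: "x \<in> part_interior G A" and cut: "{x, y} \<in> cutsets2 G"
  shows "card A \<ge> 4" "\<not> block_part G A"
proof -
  have x_single: "\<And>S. S \<in> single_cutsets G \<Longrightarrow> x \<notin> S" and xA: "x \<in> A"
    using x by (auto simp: part_interior_def)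
  obtain u v where uv: "nbrs x = {u, v}" "u \<noteq> v" "u \<noteq> y" "v \<noteq> y"
    by (rule crossed_vertex_degree[OF x_single cut])
  have "u \<in> nbrs x" "v \<in> nbrs x" using uv(1) by auto
  then have uvA: "u \<in> A" "v \<in> A" "u \<noteq> x" "v \<noteq> x"
    using part_interior_nbr[OF A x] no_loops' by auto
  have y: "y \<in> A" "x \<noteq> y" using part_interior_cut[OF assms] cutsets2_pair_distinct[OF cut] by auto
  have "finite A" using partD(1)[OF A] finite_V finite_subset by blast
  then have "card {x, u, v, y} \<le> card A" using xA uvA y by (intro card_mono) auto
  then show "card A \<ge> 4" using uv uvA y by simp
  have "(x, z) \<in> rtrancl_on (A - {u, v}) parcs' \<Longrightarrow> z = x" for z
  proof (induct rule: rtrancl_on_induct)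
    case (step z w)
    then have "(x, w) \<in> parcs G" using x_single by (auto simp: in_parcs'_iff)
    then show ?case using uv(1) step(4) by blast
  qed simp
  then have "\<not> connected (del_verts (add_cutset_edges G \<restriction> A) {u, v})"
    unfolding del_verts_induce connected_induce_iff[OF sym_parcs'] using xA y uv uvA by auto
  then have "cutset (add_cutset_edges G \<restriction> A) {u, v}"
    using uvA by (simp add: cutset_def)
  moreover have "card {u, v} < 3" using uv(2) by simp
  ultimately show "\<not> block_part G A" by (auto simp: block_part_def k_connected_def)
qed

lemma triangle_cycle_graph:
  assumes "card A = 3" "\<And>u v. u \<in> A \<Longrightarrow> v \<in> A \<Longrightarrow> u \<noteq> v \<Longrightarrow> (u, v) \<in> parcs'"
  shows "cycle_graph (add_cutset_edges G \<restriction> A)"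
proof -
  obtain a b c where A: "A = {a, b, c}" "a \<noteq> b" "b \<noteq> c" "a \<noteq> c"
    using assms(1) by (auto simp: card_3_iff)
  have ends: "parcs' \<inter> A \<times> A = symcl {(a, b), (b, c), (c, a)}"
  proof (intro set_eqI iffI; clarify)
    fix u v assume "(u, v) \<in> parcs'" "u \<in> A" "v \<in> A"
    then have "u \<noteq> v" using irrefl_parcs' by auto
    then show "(u, v) \<in> symcl {(a, b), (b, c), (c, a)}"
      using \<open>u \<in> A\<close> \<open>v \<in> A\<close> A by (auto simp: in_symcl_iff)
  next
    fix u v assume "(u, v) \<in> symcl {(a, b), (b, c), (c, a)}"
    then have "u \<in> A" "v \<in> A" "u \<noteq> v" using A by (auto simp: in_symcl_iff)
    then show "(u, v) \<in> parcs' \<inter> A \<times> A" using assms(2) by blast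
  qed
  have list: "{([a, b, c] ! i, [a, b, c] ! (Suc i mod 3)) | i. i < 3} = {(a, b), (b, c), (c, a)}"
  proof -
    have "{f i | i. i < 3} = {f 0, f 1, f 2}" for f :: "nat \<Rightarrow> 'a \<times> 'a"
      by (auto simp: less_Suc_eq numeral_3_eq_3 numeral_2_eq_2)
    then show ?thesis by simp
  qed
  have len: "length [a, b, c] = 3" by simp
  show ?thesis
    unfolding cycle_graph_def arcs_ends_part
  proof (intro exI conjI)
    show "parcs' \<inter> A \<times> A =
        symcl {([a, b, c] ! i, [a, b, c] ! (Suc i mod length [a, b, c])) | i. i < length [a, b, c]}"
      unfolding len list by (rule ends)
  qed (use A in auto)
qed

text \<open>By \<open>single_separates_of_cut_separates\<close> no 2-vertex cutset separates a
  vertex of \<open>A\<close> from \<open>x\<close>, so deleting at most two vertices of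
  \<open>A\<close> leaves the rest of \<open>A\<close> connected in \<open>G'\<close>. This gives a
  block if \<open>A\<close> has more than three vertices, and a triangle otherwise.\<close>

lemma uncut_vertex_part:
  assumes x: "x \<in> pverts G" "\<And>R. R \<in> cutsets2 G \<Longrightarrow> x \<notin> R"
  obtains A where "A \<in> parts G" "x \<in> part_interior G A"
    "block_part G A \<or> cycle_part G A \<and> card A = 3"
proof -
  obtain A where A: "A \<in> parts G" "x \<in> part_interior G A"
    using ex_part_interior[OF x(1)] x(2) single_in_cutsets2 by blast
  note AV = partD(1)[OF A(1)]
  have same: "v \<in> comp_of R x" if v: "v \<in> A" "R \<in> cutsets2 G" "v \<notin> R" for v R
  proof (rule ccontr)
    assume "v \<notin> comp_of R x"
    then obtain S where S: "S \<in> single_cutsets G" "v \<notin> S" "v \<notin> comp_of S x"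
      using single_separates_of_cut_separates[OF x v(2) _ v(3)] v(1) AV by blast
    then show False using part_interior_mem_iff[OF A, of v] v(1) AV by blast
  qed
  have conn: "v \<in> comp_of R u" if R: "R \<subseteq> A" "card R \<le> 2" and uv: "u \<in> A - R" "v \<in> A - R" for R u v
  proof -
    consider "R \<in> cutsets2 G" | "R \<notin> cutsets2 G" "card R = 2" | "card R < 2" using R(2) by linarith
    then show ?thesis
    proof cases
      case 1
      then show ?thesis using same[of u R] same[of v R] uv comp_of_sym[of u R x] comp_of_trans[of x R u v]
        by blast
    next
      case 2
      then show ?thesis using R uv AV cutsets2_iff by blast
    next
      case 3
      then show ?thesis using R uv AV by (intro comp_of_small) auto
    qed
  qed
  obtain u v where uv: "u \<in> nbrs x" "v \<in> nbrs x" "u \<noteq> v" using two_nbrs[OF x(1)] .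
  have "card {x, u, v} \<le> card A"
    using uv part_interior_nbr[OF A] A(2) AV finite_V finite_subset[of A "pverts G"]
    by (intro card_mono) (auto simp: part_interior_def)
  moreover have "card {x, u, v} = 3" using uv no_loops' by auto
  ultimately consider "card A = 3" | "card A > 3" by linarith
  then have "block_part G A \<or> cycle_part G A \<and> card A = 3"
  proof cases
    case 1
    \<comment> \<open>Deleting the third vertex \<open>z\<close> leaves only \<open>p\<close> and
      \<open>q\<close>, which can be connected in \<open>G'\<close> only by an edge.\<close>
    have "(p, q) \<in> parcs'" if pq: "p \<in> A" "q \<in> A" "p \<noteq> q" for p q
    proof (rule ccontr)
      assume no: "(p, q) \<notin> parcs'"
      have "card (A - {p, q}) = 1" using 1 pq by (simp add: card_Diff_subset)
      then obtain z where z: "A - {p, q} = {z}" by (auto simp: card_1_singleton_iff)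
      then have zA: "A - {z} = {p, q}" "z \<in> A" using pq by auto
      have "(p, q) \<in> rtrancl_on (A - {z}) parcs'"
        using conn[of "{z}" p q] zA pq by (intro part_reachable[OF A(1)]) auto
      then have "q = p"
      proof (induct rule: rtrancl_on_induct)
        case (step y w)
        then show ?case using no zA(1) by auto
      qed simp
      then show False using pq by simp
    qed
    then show ?thesis using triangle_cycle_graph 1 A(1) by (simp add: cycle_part_def)
  next
    case 2
    have "\<not> cutset (add_cutset_edges G \<restriction> A) R" if "card R < 3" for R
    proof
      assume "cutset (add_cutset_edges G \<restriction> A) R"
      then have R: "R \<subseteq> A" "\<not> connected (del_verts (add_cutset_edges G \<restriction> A) R)"
        by (auto simp: cutset_def)
      have "finite R" by (rule finite_subset[OF _ finite_V]) (use R(1) AV in blast)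
      then have "A - R \<noteq> {}" using card_mono[of R A] 2 that by (auto simp: Diff_eq_empty_iff)
      then show False using part_connected[OF A(1) conn[OF R(1)]] R(2) that by simp
    qed
    then show ?thesis using 2 A(1) by (auto simp: block_part_def k_connected_def)
  qed
  then show ?thesis using that A by blast
qed

lemma critical_iff_interiors_empty:
  "critical G \<longleftrightarrow> (\<forall>A\<in>parts G. block_part G A \<or> cycle_part G A \<and> card A = 3 \<longrightarrow>
    part_interior G A = {})"
proof (intro iffI ballI impI)
  fix A assume crit: "critical G" and A: "A \<in> parts G" "block_part G A \<or> cycle_part G A \<and> card A = 3"
  show "part_interior G A = {}"
  proof (rule ccontr)
    assume "part_interior G A \<noteq> {}"
    then obtain x where x: "x \<in> part_interior G A" by blast
    then have "x \<in> pverts G" using partD(1)[OF A(1)] by (auto simp: part_interior_def)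
    then obtain y where "{x, y} \<in> cutsets2 G" using crit by (auto simp: critical_iff)
    then show False using crossed_interior_part[OF A(1) x] A(2) by fastforce
  qed
next
  assume empty: "\<forall>A\<in>parts G. block_part G A \<or> cycle_part G A \<and> card A = 3 \<longrightarrow> part_interior G A = {}"
  have cut: "\<exists>y. {x, y} \<in> cutsets2 G" if x: "x \<in> pverts G" for x
  proof -
    obtain R where "R \<in> cutsets2 G" "x \<in> R"
      using uncut_vertex_part[OF x] empty by (metis empty_iff)
    then show ?thesis using card_2_insertE[of R x] cutsets2D(2) by metis
  qed
  \<comment> \<open>One vertex already yields a cutset, and a cutset forces at least four
    vertices.\<close>
  moreover obtain x where "x \<in> pverts G" using ex_vert_not_in[of "{}"] by auto
  ultimately show "critical G" using card_verts_of_cut critical_iff by blast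
qed

section \<open>Terminal parts\<close>

lemma terminal_part_cutset_unique:
  assumes "terminal_part G A" "S \<in> single_cutsets G" "S \<subseteq> A" "T \<in> single_cutsets G" "T \<subseteq> A"
  shows "T = S"
proof -
  let ?X = "{S \<in> single_cutsets G. S \<subseteq> A}"
  have A: "A \<in> parts G" "in_degree (BT G) (Inr A) = 1" using assms(1) by (auto simp: terminal_part_def)
  have "in_arcs (BT G) (Inr A) = (\<lambda>S. (Inl S, Inr A)) ` ?X"
    using A(1) by (auto simp: in_arcs_def BT_def in_symcl_iff)
  then have "card ?X = 1"
    using A(2) by (simp add: in_degree_def card_image inj_on_def)
  moreover have "S \<in> ?X" "T \<in> ?X" using assms(2-5) by auto
  ultimately show ?thesis by (metis card_1_singletonE singletonD)
qed

text \<open>A single cutset \<open>{x, y}\<close> inside \<open>A\<close> would equal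
  \<open>S\<close>. If \<open>y\<close> is outside \<open>A\<close>, then
  \<open>part_boundary\<close> can only return \<open>S\<close>, so \<open>S\<close> separates
  \<open>y\<close> from \<open>x\<close> and splits \<open>{x, y}\<close>.\<close>

lemma terminal_part_interior:
  assumes terminal: "terminal_part G A" and S: "S \<in> single_cutsets G" "S \<subseteq> A" and x: "x \<in> A - S"
  shows "x \<in> part_interior G A"
proof -
  have A: "A \<in> parts G" using terminal by (simp add: terminal_part_def)
  have "x \<notin> T" if T: "T \<in> single_cutsets G" for T
  proof
    assume "x \<in> T"
    then obtain y where y: "T = {x, y}" "x \<noteq> y"
      using card_2_insertE cutsets2D(2)[OF single_in_cutsets2[OF T]] by metis
    show False
    proof (cases "y \<in> A")
      case True
      then show False using terminal_part_cutset_unique[OF terminal S T] x y(1) by blast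
    next
      case False
      then have "y \<in> pverts G - A" using cutsets2D(1)[OF single_in_cutsets2[OF T]] y by blast
      then obtain S' where "S' \<in> single_cutsets G" "S' \<subset> A" "y \<notin> S'" "comp_of S' y \<inter> A = {}"
        using part_boundary[OF A] by metis
      then have "y \<notin> S" "comp_of S y \<inter> A = {}"
        using terminal_part_cutset_unique[OF terminal S, of S'] by auto
      moreover have "x \<in> comp_of S y"
        using single_not_splitsD(1)[OF S(1) single_in_cutsets2[OF T], of y x] x y(1) \<open>y \<notin> S\<close> by blast
      ultimately show False using x by blast
    qed
  qed
  then show ?thesis using x by (auto simp: part_interior_def)
qed

lemma terminal_part_neq_cutset:
  assumes terminal: "terminal_part G A" and S: "S \<in> single_cutsets G" "S \<subseteq> A"
  shows "A - S \<noteq> {}"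
proof
  assume "A - S = {}"
  then have "A = S" using S(2) by blast
  have A: "A \<in> parts G" using terminal by (simp add: terminal_part_def)
  obtain w where "w \<in> pverts G - A"
    using cutsets2D(3)[OF single_in_cutsets2[OF S(1)]] \<open>A = S\<close> by blast
  then obtain S' where "S' \<in> single_cutsets G" "S' \<subset> A" using part_boundary[OF A] by metis
  then show False using terminal_part_cutset_unique[OF terminal S, of S'] \<open>A = S\<close> by blast
qed

text \<open>The vertices of \<open>A - S\<close> are interior and lie in 2-vertex cutsets, so they
  have degree 2. They stay connected because \<open>S\<close> does not split \<open>A\<close>, and
  \<open>S\<close> is an edge of \<open>G'\<close>: the situation of
  \<open>cycle_list_exists\<close>.\<close>

lemma critical_terminal_part:
  assumes crit: "critical G" and terminal: "terminal_part G A" and S: "S \<in> single_cutsets G" "S \<subseteq> A"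
  shows "cycle_part G A" "card A \<ge> 4" "\<And>x. x \<in> A - S \<Longrightarrow> card (nbrs x) = 2"
proof -
  have A: "A \<in> parts G" using terminal by (simp add: terminal_part_def)
  note AV = partD(1)[OF A] and int = terminal_part_interior[OF terminal S]
  have cut: "\<exists>y. {x, y} \<in> cutsets2 G" if "x \<in> A - S" for x
    using crit that AV by (auto simp: critical_iff)
  have single: "x \<notin> T" if "x \<in> A - S" "T \<in> single_cutsets G" for x T
    using int[OF that(1)] that(2) by (auto simp: part_interior_def)
  show deg: "card (nbrs x) = 2" if x: "x \<in> A - S" for x
  proof -
    obtain y where "{x, y} \<in> cutsets2 G" using cut[OF x] by blast
    then obtain u v where "nbrs x = {u, v}" "u \<noteq> v"
      using crossed_vertex_degree single[OF x] by metis
    then show ?thesis by simp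
  qed
  obtain x where x: "x \<in> A - S" using terminal_part_neq_cutset[OF terminal S] by blast
  show "card A \<ge> 4" using crossed_interior_part(1)[OF A int[OF x]] cut[OF x] by blast
  obtain a b where ab: "S = {a, b}" "a \<noteq> b"
    using cutsets2D(2)[OF single_in_cutsets2[OF S(1)]] by (auto simp: card_2_iff)
  let ?r = "parcs' \<inter> A \<times> A"
  \<comment> \<open>Biconnectivity lets \<open>x\<close> reach \<open>p\<close> after deletion of
    \<open>q\<close>; without a neighbour of \<open>p\<close> in \<open>A - S\<close>, the walk
    could never leave \<open>A - S\<close>.\<close>
  have to_nbr: "\<exists>y\<in>A - {p, q}. (p, y) \<in> ?r" if S_eq: "S = {p, q}" "p \<noteq> q" for p q
  proof (rule ccontr)
    assume no: "\<not> ?thesis"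
    have pA: "p \<in> A" "q \<in> A" using S(2) S_eq by auto
    have "(x, p) \<in> rtrancl_on (A - {q}) parcs'"
      using x pA S_eq AV by (intro part_reachable[OF A] comp_of_small) auto
    then have "p \<in> A - S"
    proof (induct rule: rtrancl_on_induct)
      case base
      then show ?case using x by simp
    next
      case (step y z)
      then have "z \<noteq> p" using no S_eq symD[OF sym_parcs'] pA by auto
      then show ?case using step S_eq by blast
    qed
    then show False using S_eq by blast
  qed
  have "\<exists>vs. distinct vs \<and> length vs \<ge> 3 \<and> set vs = A \<and>
    ?r = symcl {(vs ! i, vs ! (Suc i mod length vs)) | i. i < length vs}"
  proof (rule cycle_list_exists)
    show "finite A" by (rule finite_subset[OF AV finite_V])
    show "sym ?r" using sym_parcs' by (auto simp: sym_def)
    show "irrefl ?r" using irrefl_parcs' by (auto simp: irrefl_def)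
    show "a \<in> A" "b \<in> A" using S(2) ab by auto
    then show "(a, b) \<in> ?r" using S(1) ab by (auto simp: in_parcs'_iff)
    show "card {y. (x, y) \<in> ?r} = 2" if "x \<in> A - {a, b}" for x
    proof -
      have x: "x \<in> A - S" using that ab by simp
      have "{y. (x, y) \<in> ?r} = nbrs x"
        using x single[OF x] part_interior_nbr[OF A int[OF x]] by (auto simp: in_parcs'_iff)
      then show ?thesis using deg[OF x] by simp
    qed
    show "(u, v) \<in> rtrancl_on (A - {a, b}) ?r" if "u \<in> A - {a, b}" "v \<in> A - {a, b}" for u v
    proof -
      have "(u, v) \<in> rtrancl_on (A - S) parcs'"
        using that ab(1) partD(2)[OF A S(1)] by (intro part_reachable[OF A]) auto
      then show ?thesis using ab(1) by (elim rtrancl_on_mono_set) auto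
    qed
    show "\<exists>y\<in>A - {a, b}. (a, y) \<in> ?r" using to_nbr ab by blast
    show "\<exists>y\<in>A - {a, b}. (b, y) \<in> ?r" using to_nbr[of b a] ab by (simp add: insert_commute)
  qed (use ab in auto)
  then show "cycle_part G A"
    using A unfolding cycle_part_def cycle_graph_def arcs_ends_part by simp
qed

section \<open>Vertices of degree two\<close>

text \<open>If a single cutset \<open>T\<close> meets the component, it has a component strictly
  inside, and the induction descends. Otherwise all vertices of the component have degree 2, and a
  second one besides \<open>u\<close> is exhibited.\<close>

lemma critical_comp_two_degree_two:
  assumes crit: "critical G" and "S \<in> single_cutsets G" "u \<in> pverts G - S"
  obtains p q where "p \<in> comp_of S u" "q \<in> comp_of S u" "p \<noteq> q" "card (nbrs p) = 2" "card (nbrs q) = 2"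
  using assms(2,3)
proof (induction "card (comp_of S u)" arbitrary: S u thesis rule: less_induct)
  case less
  note S = \<open>S \<in> single_cutsets G\<close> and u = \<open>u \<in> pverts G - S\<close>
  note S_cut = single_in_cutsets2[OF S]
  show ?case
  proof (cases "\<exists>T\<in>single_cutsets G. T \<inter> comp_of S u \<noteq> {}")
    case True
    then obtain T c where T: "T \<in> single_cutsets G" and c: "c \<in> T" "c \<in> comp_of S u" by blast
    note T_cut = single_in_cutsets2[OF T]
    have cS: "c \<notin> S" using c comp_of_subset by blast
    have "\<not> S \<subseteq> T"
      using card_subset_eq[OF cutsets2D(4)[OF T_cut], of S] cutsets2D(2)[OF S_cut] cutsets2D(2)[OF T_cut] c cS
      by auto
    then obtain s where s: "s \<in> S" "s \<notin> T" by blast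
    \<comment> \<open>\<open>v\<close> is beyond \<open>T\<close> as seen from \<open>s\<close>. Its
      component avoids \<open>S\<close>, since \<open>T\<close> does not split \<open>S\<close>;
      attached to \<open>c\<close>, it lies in the component of \<open>u\<close>, and it lacks
      \<open>c\<close>.\<close>
    obtain v where v: "v \<in> pverts G - T" "v \<notin> comp_of T s" using comp_of_other[OF T_cut] .
    have disj: "comp_of T v \<inter> S = {}"
    proof (rule ccontr)
      assume "comp_of T v \<inter> S \<noteq> {}"
      then obtain t where t: "t \<in> S" "t \<in> comp_of T v" by blast
      then have "t \<in> comp_of T s"
        using single_not_splitsD(2)[OF S T_cut, of s t] s comp_of_subset[of t T v] by blast
      then show False using v(2) t(2) comp_of_sym[of t T v] comp_of_trans[of t T s v] by blast
    qed
    have "c \<in> comp_of S v"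
      using comp_of_attach[OF cutsets2D(1,2)[OF T_cut] v(1) c(1) cS disj] .
    then have "comp_of S v = comp_of S u"
      using c(2) comp_of_eq[of c S v] comp_of_eq[of c S u] by simp
    then have sub: "comp_of T v \<subset> comp_of S u"
      using comp_of_avoid[OF disj] c comp_of_subset[of c T v] by blast
    show ?thesis
      using less.hyps[OF card_comp_of_less[OF sub] _ T v(1)] less.prems(1) sub by blast
  next
    case False
    have deg: "card (nbrs x) = 2" if x: "x \<in> comp_of S u" for x
    proof -
      obtain y where y: "{x, y} \<in> cutsets2 G" using crit comp_of_subset[OF x] by (auto simp: critical_iff)
      have "\<And>T. T \<in> single_cutsets G \<Longrightarrow> x \<notin> T" using False x by blast
      then obtain p q where "nbrs x = {p, q}" "p \<noteq> q" using crossed_vertex_degree[OF _ y] by metis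
      then show ?thesis by simp
    qed
    have uu: "u \<in> comp_of S u" using u comp_of_refl by blast
    \<comment> \<open>If all neighbours of \<open>u\<close> are in \<open>S\<close>, they make up
      \<open>S\<close>. The partner \<open>y\<close> of \<open>u\<close> in a cutset is then outside
      \<open>S\<close>, and lies in the component because \<open>S\<close> does not split
      \<open>{u, y}\<close>.\<close>
    have "\<exists>w\<in>comp_of S u. w \<noteq> u"
    proof (cases "nbrs u \<subseteq> S")
      case True
      obtain y where y: "{u, y} \<in> cutsets2 G" using crit u by (auto simp: critical_iff)
      have "\<And>T. T \<in> single_cutsets G \<Longrightarrow> u \<notin> T" using False uu by blast
      then obtain p q where pq: "nbrs u = {p, q}" "p \<noteq> q" "p \<noteq> y" "q \<noteq> y"
        using crossed_vertex_degree[OF _ y] by metis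
      then have "S = {p, q}"
        using True card2_eqI[OF cutsets2D(2)[OF S_cut], of p q] by blast
      then have "y \<in> comp_of S u"
        using single_not_splitsD(1)[OF S y, of u y] u pq by blast
      then show ?thesis using cutsets2_pair_distinct[OF y] by metis
    next
      case False
      then obtain w where "(u, w) \<in> parcs G" "w \<notin> S" by blast
      then show ?thesis using comp_of_step[OF uu, of w] no_loops'[of u w] by metis
    qed
    then show ?thesis using less.prems(1) deg uu by blast
  qed
qed

text \<open>Without single cutsets all vertices have degree 2; otherwise two components left by a
  single cutset supply two such vertices each.\<close>

lemma critical_four_degree_two:
  assumes crit: "critical G"
  shows "card {x \<in> pverts G. card (nbrs x) = 2} \<ge> 4"
proof (cases "single_cutsets G = {}")
  case True
  have "card (nbrs x) = 2" if x: "x \<in> pverts G" for x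
  proof -
    obtain y where y: "{x, y} \<in> cutsets2 G" using crit x by (auto simp: critical_iff)
    have "\<And>T. T \<in> single_cutsets G \<Longrightarrow> x \<notin> T" using True by blast
    then obtain p q where "nbrs x = {p, q}" "p \<noteq> q" using crossed_vertex_degree[OF _ y] by metis
    then show ?thesis by simp
  qed
  then have "{x \<in> pverts G. card (nbrs x) = 2} = pverts G" by blast
  then show ?thesis using crit by (simp add: critical_iff)
next
  case False
  then obtain S where S: "S \<in> single_cutsets G" by blast
  obtain u v where uv: "u \<in> pverts G - S" "v \<in> pverts G - S" "v \<notin> comp_of S u"
    using single_in_cutsets2[OF S] by (auto simp: cutsets2_iff)
  obtain p q where pq: "p \<in> comp_of S u" "q \<in> comp_of S u" "p \<noteq> q" "card (nbrs p) = 2" "card (nbrs q) = 2"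
    by (rule critical_comp_two_degree_two[OF crit S uv(1)])
  obtain p' q' where pq': "p' \<in> comp_of S v" "q' \<in> comp_of S v" "p' \<noteq> q'" "card (nbrs p') = 2" "card (nbrs q') = 2"
    by (rule critical_comp_two_degree_two[OF crit S uv(2)])
  have disj: "comp_of S u \<inter> comp_of S v = {}"
  proof (rule ccontr)
    assume "comp_of S u \<inter> comp_of S v \<noteq> {}"
    then obtain z where "z \<in> comp_of S u" "z \<in> comp_of S v" by blast
    then show False using uv(3) comp_of_sym[of z S v] comp_of_trans[of z S u v] by blast
  qed
  have "card {p, q, p', q'} = 4"
  proof -
    have "{p, q} \<inter> {p', q'} = {}" using pq pq' disj by blast
    then show ?thesis using pq(3) pq'(3) by auto
  qed
  moreover have "card {p, q, p', q'} \<le> card {x \<in> pverts G. card (nbrs x) = 2}"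
    using pq pq' comp_of_subset finite_V by (intro card_mono) auto
  ultimately show ?thesis by simp
qed

end

theorem theorem6:
  fixes G :: "'a pair_pre_digraph"
  assumes "pair_graph G" and "biconnected G"
  shows "(critical G \<longleftrightarrow>
            (\<forall>A \<in> parts G. block_part G A \<or> cycle_part G A \<and> card A = 3 \<longrightarrow>
               part_interior G A = {})) \<and>
         (critical G \<longrightarrow>
            (\<forall>A S. terminal_part G A \<and> S \<in> single_cutsets G \<and> (Inl S, Inr A) \<in> parcs (BT G) \<longrightarrow>
               cycle_part G A \<and> card A \<ge> 4 \<and> (\<forall>x \<in> A - S. in_degree G x = 2))) \<and>
         (critical G \<longrightarrow> card {x \<in> pverts G. in_degree G x = 2} \<ge> 4)"
proof -
  interpret pair_graph G by (rule assms(1))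
  interpret biconnected_graph G by unfold_locales (rule assms(2))
  show ?thesis
  proof (intro conjI impI allI)
    show "critical G \<longleftrightarrow> (\<forall>A\<in>parts G. block_part G A \<or> cycle_part G A \<and> card A = 3 \<longrightarrow>
        part_interior G A = {})"
      by (rule critical_iff_interiors_empty)
    show "card {x \<in> pverts G. in_degree G x = 2} \<ge> 4" if "critical G"
      using critical_four_degree_two[OF that] by (simp add: in_degree_eq_card)
    fix A S
    assume crit: "critical G"
      and *: "terminal_part G A \<and> S \<in> single_cutsets G \<and> (Inl S, Inr A) \<in> parcs (BT G)"
    then have "S \<subseteq> A" by (auto simp: BT_def in_symcl_iff)
    with crit * show "cycle_part G A" "card A \<ge> 4" "\<forall>x\<in>A - S. in_degree G x = 2"
      using critical_terminal_part[of A S] by (auto simp: in_degree_eq_card)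
  qed
qed

end
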